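(* Let $n\geq 12$. Among all bicyclic graphs of order $n$, $G_1$ and $G_2$ are the graphs with the largest and the second largest value of $\rho_{ex}(G)$, respectively, where $G_1$ is obtained from $K_4$ minus an edge by attaching $n-4$ pendant vertices to one of its vertices of degree $3$, and $G_2$ is obtained from two triangles sharing exactly one vertex $c$ by attaching $n-5$ pendant vertices to $c$. Furthermore, $$\rho_{ex}(G_1)>\tfrac{1}{2}(n-0.9)\sqrt{n-3.8}>\rho_{ex}(G_2)>\tfrac{1}{2}(n-0.9)\sqrt{n-5}.$$
   Context: All graphs are finite, simple and connected. A bicyclic graph of order $n$ is a connected simple graph with $n$ vertices and $n+1$ edges. The extended adjacency matrix $A_{ex}(G)=[a_{ij}]$ of a graph $G$ with vertex degrees $d_i$ is defined by $a_{ij}=\frac12\left(\frac{d_i}{d_j}+\frac{d_j}{d_i}\right)$ if $ij$ is an edge and $a_{ij}=0$ otherwise; $\rho_{ex}(G)$ denotes its spectral radius. *)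

theory Defs
  imports
    "Jordan_Normal_Form.Spectral_Radius"
    "Graph_Theory.Digraph_Component"
    "Graph_Theory.Digraph_Isomorphism"
begin

text \<open>
  A finite simple graph is a \<open>pair_graph\<close>: each edge uv is stored as the two arcs
  (u, v) and (v, u), so the degree of a vertex is its out-degree.
\<close>

definition edges :: "'a pair_pre_digraph \<Rightarrow> 'a set set" where
  "edges G = (\<lambda>(u, v). {u, v}) ` parcs G"

text \<open>The qualifier distinguishes graph connectedness from topological connectedness.\<close>

definition bicyclic :: "'a pair_pre_digraph \<Rightarrow> bool" where
  "bicyclic G \<longleftrightarrow> pair_graph G \<and> Digraph_Component.connected (with_proj G) \<and>
     card (edges G) = card (pverts G) + 1"

definition deg :: "'a pair_pre_digraph \<Rightarrow> 'a \<Rightarrow> nat" where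
  "deg G v = out_degree (with_proj G) v"

definition ext_adj :: "'a pair_pre_digraph \<Rightarrow> 'a \<Rightarrow> 'a \<Rightarrow> real" where
  "ext_adj G u v =
     (if (u, v) \<in> parcs G
      then 1/2 * (real (deg G u) / real (deg G v) + real (deg G v) / real (deg G u))
      else 0)"

text \<open>The extended adjacency matrix with rows and columns ordered by the vertex list \<open>vs\<close>.
  It is taken over the complex numbers because the library's \<open>spectral_radius\<close>
  is defined there.\<close>

definition ext_adj_mat :: "'a pair_pre_digraph \<Rightarrow> 'a list \<Rightarrow> complex mat" where
  "ext_adj_mat G vs = mat (length vs) (length vs)
     (\<lambda>(i, j). complex_of_real (ext_adj G (vs ! i) (vs ! j)))"

text \<open>The choice of the vertex ordering is irrelevant, see \<open>rho_ex_eq\<close> below.\<close>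

definition rho_ex :: "'a pair_pre_digraph \<Rightarrow> real" where
  "rho_ex G = spectral_radius
     (ext_adj_mat G (SOME vs. distinct vs \<and> set vs = pverts G))"

lemma eigenvalue_ext_adj_mat:
  assumes "distinct vs"
  shows "eigenvalue (ext_adj_mat G vs) k \<longleftrightarrow>
    (\<exists>x. (\<exists>u\<in>set vs. x u \<noteq> 0) \<and>
      (\<forall>u\<in>set vs. (\<Sum>v\<in>set vs. complex_of_real (ext_adj G u v) * x v) = k * x u))"
    (is "?L \<longleftrightarrow> ?R")
proof -
  let ?n = "length vs"
  have row: "(ext_adj_mat G vs *\<^sub>v vec ?n (\<lambda>i. x (vs ! i))) $ i =
      (\<Sum>v\<in>set vs. complex_of_real (ext_adj G (vs ! i) v) * x v)" if "i < ?n" for x i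
  proof -
    have "(\<Sum>v\<in>set vs. complex_of_real (ext_adj G (vs ! i) v) * x v) =
        (\<Sum>j<?n. complex_of_real (ext_adj G (vs ! i) (vs ! j)) * x (vs ! j))"
      using bij_betw_nth[OF assms refl refl] by (simp add: sum.reindex_bij_betw[symmetric])
    then show ?thesis
      using that by (simp add: ext_adj_mat_def scalar_prod_def lessThan_atLeast0)
  qed
  have dim: "dim_row (ext_adj_mat G vs) = ?n" by (simp add: ext_adj_mat_def)
  have ev: "eigenvector (ext_adj_mat G vs) (vec ?n (\<lambda>i. x (vs ! i))) k \<longleftrightarrow>
      (\<exists>u\<in>set vs. x u \<noteq> 0) \<and>
      (\<forall>u\<in>set vs. (\<Sum>v\<in>set vs. complex_of_real (ext_adj G u v) * x v) = k * x u)" for x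
    unfolding eigenvector_def dim
    by (auto simp: vec_eq_iff dim row all_set_conv_all_nth set_conv_nth[of vs] simp del: index_mult_mat_vec)
  show ?thesis
  proof
    assume ?L
    then obtain v where v: "eigenvector (ext_adj_mat G vs) v k"
      by (auto simp: eigenvalue_def)
    define x where "x u = v $ (the_inv_into {..<?n} ((!) vs) u)" for u
    have "inj_on ((!) vs) {..<?n}" using bij_betw_nth[OF assms refl refl] by (simp add: bij_betw_def)
    moreover have "dim_vec v = ?n" using v by (auto simp: eigenvector_def dim)
    ultimately have "v = vec ?n (\<lambda>i. x (vs ! i))"
      by (auto simp: x_def vec_eq_iff the_inv_into_f_f)
    with v ev[of x] show ?R by metis
  next
    assume ?R
    with ev show ?L unfolding eigenvalue_def by blast
  qed
qed

lemma rho_ex_eq: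
  assumes "distinct vs" "set vs = pverts G"
  shows "rho_ex G = spectral_radius (ext_adj_mat G vs)"
proof -
  let ?ws = "SOME vs. distinct vs \<and> set vs = pverts G"
  have "distinct ?ws \<and> set ?ws = pverts G"
    by (rule someI[of _ vs]) (use assms in simp)
  then have "spectrum (ext_adj_mat G ?ws) = spectrum (ext_adj_mat G vs)"
    using assms
    by (auto simp: spectrum_def eigenvalue_ext_adj_mat[of vs] eigenvalue_ext_adj_mat[of ?ws])
  then show ?thesis by (simp add: rho_ex_def spectral_radius_def)
qed

text \<open>\<open>K\<^sub>4\<close> minus an edge lives on the vertices 0, 1, 2, 3, the missing edge being \<open>{2, 3}\<close>;
  the pendant vertices 4, ..., n - 1 are attached to 0.\<close>

definition G1 :: "nat \<Rightarrow> nat pair_pre_digraph" where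
  "G1 n = mk_symmetric (with_proj
     \<lparr> pverts = {0..<n},
       parcs = {(0,1), (0,2), (0,3), (1,2), (1,3)} \<union> (\<lambda>i. (0, i)) ` {4..<n} \<rparr>)"

text \<open>The triangles are 0, 1, 2 and 0, 3, 4; the pendant vertices 5, ..., n - 1
  are attached to 0.\<close>

definition G2 :: "nat \<Rightarrow> nat pair_pre_digraph" where
  "G2 n = mk_symmetric (with_proj
     \<lparr> pverts = {0..<n},
       parcs = {(0,1), (0,2), (1,2), (0,3), (0,4), (3,4)} \<union> (\<lambda>i. (0, i)) ` {5..<n} \<rparr>)"

end

theory Submission
  imports Defs
begin

text \<open>
  If \<open>x\<close> is a positive vector with \<open>(A x)\<^sub>u < l x\<^sub>u\<close> for all vertices \<open>u\<close>, then \<open>\<rho>\<^sub>e\<^sub>x < l\<close>. With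
  \<open>l = (n - 0.9) sqrt (n - 5) / 2\<close>, such an \<open>x\<close> exists whenever the maximum degree \<open>\<Delta>\<close> is at most
  \<open>n - 2\<close>: for \<open>\<Delta> \<le> n - 3\<close> take the square roots of the degrees, which only needs the degree sum
  \<open>2 n + 2\<close>; for \<open>\<Delta> = n - 2\<close> take weights close to the Perron vector of the star around the vertex of
  maximum degree. For \<open>\<Delta> = n - 1\<close> the two edges missing the dominating vertex either meet, which gives
  \<open>G\<^sub>1\<close>, or are disjoint, which gives \<open>G\<^sub>2\<close>. The lower bounds come from
  \<open>\<rho>\<^sub>e\<^sub>x\<^sup>2 \<ge> \<Sum>\<^sub>v a\<^sub>c\<^sub>v\<^sup>2\<close> for the dominating vertex \<open>c\<close>.
\<close>

section \<open>Bounds for the spectral radius\<close>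

text \<open>Among the closed walks at \<open>i\<close>, the one that never leaves \<open>i\<close>
  contributes \<open>(B $$ (i, i)) ^ k\<close>, and the others contribute nonnegative amounts.
  Nonnegativity of all entries belongs to the claim because the induction step drops terms.\<close>

lemma pow_mat_diag_ge:
  fixes B :: "real mat"
  assumes B: "B \<in> carrier_mat n n" and nonneg: "\<And>i j. i < n \<Longrightarrow> j < n \<Longrightarrow> B $$ (i, j) \<ge> 0"
    and i: "i < n"
  shows "(B ^\<^sub>m k) $$ (i, i) \<ge> (B $$ (i, i)) ^ k \<and>
    (\<forall>a<n. \<forall>b<n. (B ^\<^sub>m k) $$ (a, b) \<ge> 0)"
proof (induction k)
  case 0
  show ?case using B i by auto
next
  case (Suc k)
  have C: "B ^\<^sub>m k \<in> carrier_mat n n" using B by auto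
  have entry: "(B ^\<^sub>m Suc k) $$ (a, b) = (\<Sum>j<n. (B ^\<^sub>m k) $$ (a, j) * B $$ (j, b))"
    if "a < n" "b < n" for a b
    using that B C by (simp add: scalar_prod_def lessThan_atLeast0)
  have "(B $$ (i, i)) ^ Suc k \<le> (B ^\<^sub>m k) $$ (i, i) * B $$ (i, i)"
    using Suc.IH nonneg[OF i i] by (simp add: mult.commute mult_left_mono)
  also have "\<dots> \<le> (\<Sum>j<n. (B ^\<^sub>m k) $$ (i, j) * B $$ (j, i))"
    using Suc.IH i nonneg
    by (intro member_le_sum[where f = "\<lambda>j. (B ^\<^sub>m k) $$ (i, j) * B $$ (j, i)"]) auto
  finally show ?case
    using entry i Suc.IH nonneg by (auto intro!: sum_nonneg)
qed

lemma spectral_radius_nonneg: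
  assumes "A \<in> carrier_mat n n" "n > 0"
  shows "spectral_radius A \<ge> 0"
  using spectral_radius_mem_max(1)[OF assms] by auto

lemma spectral_radius_smult_le:
  assumes A: "A \<in> carrier_mat n n" and n: "n > 0" and c: "c \<noteq> 0"
  shows "spectral_radius (c \<cdot>\<^sub>m A) \<le> norm c * spectral_radius A"
proof -
  have cA: "c \<cdot>\<^sub>m A \<in> carrier_mat n n" using A by auto
  obtain k where k: "k \<in> spectrum (c \<cdot>\<^sub>m A)" "spectral_radius (c \<cdot>\<^sub>m A) = norm k"
    using spectral_radius_mem_max(1)[OF cA n] by auto
  then obtain v where v: "eigenvector (c \<cdot>\<^sub>m A) v k"
    by (auto simp: spectrum_def eigenvalue_def)
  then have vn: "v \<in> carrier_vec n" "v \<noteq> 0\<^sub>v n" "(c \<cdot>\<^sub>m A) *\<^sub>v v = k \<cdot>\<^sub>v v"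
    using A by (auto simp: eigenvector_def)
  then have "c \<cdot>\<^sub>v (A *\<^sub>v v) = k \<cdot>\<^sub>v v"
    using A by (intro eq_vecI) (auto simp: scalar_prod_def sum_distrib_left mult.assoc vec_eq_iff)
  then have "(1 / c) \<cdot>\<^sub>v (c \<cdot>\<^sub>v (A *\<^sub>v v)) = (1 / c) \<cdot>\<^sub>v (k \<cdot>\<^sub>v v)" by simp
  then have "A *\<^sub>v v = (k / c) \<cdot>\<^sub>v v"
    using c by (simp add: smult_smult_assoc)
  then have "k / c \<in> spectrum A"
    using vn A by (auto simp: spectrum_def eigenvalue_def eigenvector_def)
  then have "norm (k / c) \<le> spectral_radius A"
    using spectral_radius_mem_max(2)[OF A n] by auto
  then show ?thesis
    using c k(2) by (simp add: norm_divide field_simps)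
qed

text \<open>Otherwise divide \<open>B\<close> by some \<open>r\<close> strictly between its spectral
  radius and the square root of the diagonal entry. The powers of the quotient stay bounded,
  although the diagonal entry of the powers of its square grows geometrically.\<close>

lemma mult_diag_le_spectral_radius_square:
  fixes B :: "real mat"
  assumes B: "B \<in> carrier_mat n n" and nonneg: "\<And>i j. i < n \<Longrightarrow> j < n \<Longrightarrow> B $$ (i, j) \<ge> 0"
    and i: "i < n"
  shows "(B * B) $$ (i, i) \<le> (spectral_radius (map_mat complex_of_real B))\<^sup>2"
proof (rule ccontr)
  let ?A = "map_mat complex_of_real B"
  define s where "s = (B * B) $$ (i, i)"
  have A: "?A \<in> carrier_mat n n" and BB: "B * B \<in> carrier_mat n n" and n: "n > 0"
    using B i by auto
  assume "\<not> ?thesis"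
  then have lt: "(spectral_radius ?A)\<^sup>2 < s" by (simp add: s_def)
  then have s: "s > 0" by (meson le_less_trans zero_le_power2)
  have "spectral_radius ?A < sqrt s"
    using lt real_less_rsqrt by blast
  then obtain r where r: "spectral_radius ?A < r" "r < sqrt s" using dense by blast
  have r0: "r > 0" using r(1) spectral_radius_nonneg[OF A n] by linarith
  have q: "s / r\<^sup>2 > 1"
    proof -
    have "r\<^sup>2 < (sqrt s)\<^sup>2" using r(2) r0 by (intro power_strict_mono) auto
    then show ?thesis using s r0 by simp
  qed
  define C where "C = (1 / r) \<cdot>\<^sub>m B"
  have C: "C \<in> carrier_mat n n" using B by (simp add: C_def)
  have CC: "C * C \<in> carrier_mat n n" using C by simp
  have mC: "map_mat complex_of_real C = complex_of_real (1 / r) \<cdot>\<^sub>m ?A"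
    using B by (intro eq_matI) (auto simp: C_def)
  have "spectral_radius (complex_of_real (1 / r) \<cdot>\<^sub>m ?A) \<le> norm (complex_of_real (1 / r)) * spectral_radius ?A"
    using r0 by (intro spectral_radius_smult_le[OF A n]) auto
  also have "\<dots> < 1" using r r0 by (simp add: norm_divide)
  finally have "spectral_radius (map_mat complex_of_real C) < 1" by (simp add: mC)
  \<comment> \<open>By the Jordan normal form, the powers of a matrix of spectral radius below 1
    have uniformly bounded entries.\<close>
  then obtain c where c: "\<And>k. norm_bound (map_mat complex_of_real C ^\<^sub>m k) c"
    using spectral_radius_jnf_norm_bound_less_1_upper_triangular[of "map_mat complex_of_real C" n] C
    by auto
  have hom: "map_mat complex_of_real C ^\<^sub>m k = map_mat complex_of_real (C ^\<^sub>m k)" for k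
    using of_real_hom.mat_hom_pow[OF C, symmetric] .
  have bound: "(C ^\<^sub>m k) $$ (i, i) \<le> c" for k
  proof -
    have "C ^\<^sub>m k \<in> carrier_mat n n" using C by simp
    then have "norm (complex_of_real ((C ^\<^sub>m k) $$ (i, i))) \<le> c"
      using c[of k] i C unfolding norm_bound_def hom
      by (metis carrier_matD index_map_mat)
    then show ?thesis by simp
  qed
  have CCi: "(C * C) $$ (i, i) = s / r\<^sup>2"
    using B i by (simp add: C_def s_def scalar_prod_def power2_eq_square sum_divide_distrib)
  have CC0: "(C * C) $$ (a, b) \<ge> 0" if "a < n" "b < n" for a b
    using B that r0 nonneg by (auto simp: C_def scalar_prod_def intro!: sum_nonneg)
  have pow: "(C * C) ^\<^sub>m k = C ^\<^sub>m (2 * k)" for k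
  proof (induction k)
    case (Suc k)
    have "C ^\<^sub>m (2 * k) \<in> carrier_mat n n" using C by simp
    then show ?case using Suc C by (simp add: assoc_mult_mat[of _ n n _ n _ n])
  qed (use C in auto)
  have le: "(s / r\<^sup>2) ^ k \<le> c" for k
    using pow_mat_diag_ge[OF CC CC0 i, of k] bound[of "2 * k"] unfolding CCi pow by auto
  obtain k where "c < (s / r\<^sup>2) ^ k" using real_arch_pow[OF q] by blast
  with le[of k] show False by simp
qed

lemma ext_adj_nonneg: "ext_adj G u v \<ge> 0"
  by (simp add: ext_adj_def)

text \<open>The left side is the diagonal entry at \<open>u\<close> of the squared matrix.\<close>

lemma rho_ex_square_ge:
  assumes fin: "finite (pverts G)" and u: "u \<in> pverts G"
  shows "(\<Sum>v\<in>pverts G. ext_adj G u v * ext_adj G v u) \<le> (rho_ex G)\<^sup>2"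
proof -
  obtain vs where vs: "distinct vs" "set vs = pverts G"
    using finite_distinct_list[OF fin] by blast
  let ?n = "length vs"
  define B where "B = mat ?n ?n (\<lambda>(i, j). ext_adj G (vs ! i) (vs ! j))"
  have B: "B \<in> carrier_mat ?n ?n" by (simp add: B_def)
  obtain i where i: "i < ?n" "vs ! i = u" using u vs by (metis in_set_conv_nth)
  have "(\<Sum>v\<in>pverts G. ext_adj G u v * ext_adj G v u) =
      (\<Sum>j<?n. ext_adj G u (vs ! j) * ext_adj G (vs ! j) u)"
    using bij_betw_nth[OF vs(1) refl refl] vs(2) by (simp add: sum.reindex_bij_betw[symmetric])
  also have "\<dots> = (B * B) $$ (i, i)"
    using i by (simp add: B_def scalar_prod_def lessThan_atLeast0)
  also have "\<dots> \<le> (spectral_radius (map_mat complex_of_real B))\<^sup>2"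
    using i by (intro mult_diag_le_spectral_radius_square[OF B]) (auto simp: B_def ext_adj_nonneg)
  also have "map_mat complex_of_real B = ext_adj_mat G vs"
    by (intro eq_matI) (auto simp: B_def ext_adj_mat_def)
  finally show ?thesis by (simp add: rho_ex_eq[OF vs])
qed

text \<open>The Collatz--Wielandt bound: compare \<open>x\<close> with an eigenvector at a vertex
  maximizing the ratio of the entries.\<close>

lemma rho_ex_less:
  assumes fin: "finite (pverts G)" and ne: "pverts G \<noteq> {}"
    and pos: "\<And>u. u \<in> pverts G \<Longrightarrow> x u > 0"
    and less: "\<And>u. u \<in> pverts G \<Longrightarrow> (\<Sum>v\<in>pverts G. ext_adj G u v * x v) < l * x u"
  shows "rho_ex G < l"
proof -
  let ?V = "pverts G"
  obtain vs where vs: "distinct vs" "set vs = ?V"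
    using finite_distinct_list[OF fin] by blast
  have A: "ext_adj_mat G vs \<in> carrier_mat (length vs) (length vs)"
    by (simp add: ext_adj_mat_def)
  have "length vs > 0" using vs ne by auto
  then obtain k where k: "k \<in> spectrum (ext_adj_mat G vs)" "rho_ex G = norm k"
    using spectral_radius_mem_max(1)[OF A] by (auto simp: rho_ex_eq[OF vs])
  then obtain y where y: "\<exists>u\<in>?V. y u \<noteq> 0"
    "\<And>u. u \<in> ?V \<Longrightarrow> (\<Sum>v\<in>?V. complex_of_real (ext_adj G u v) * y v) = k * y u"
    by (auto simp: spectrum_def eigenvalue_ext_adj_mat[OF vs(1)] vs(2))
  let ?R = "(\<lambda>v. norm (y v) / x v) ` ?V"
  have R: "finite ?R" "?R \<noteq> {}" using fin ne by auto
  obtain u where "u \<in> ?V" "Max ?R = norm (y u) / x u"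
    using Max_in[OF R] by auto
  then have u: "u \<in> ?V" "\<And>v. v \<in> ?V \<Longrightarrow> norm (y v) / x v \<le> norm (y u) / x u"
    using Max_ge[OF R(1)] by auto
  \<comment> \<open>The maximal ratio is positive since the eigenvector is nonzero. This keeps the
    final comparison strict.\<close>
  obtain w where w: "w \<in> ?V" "y w \<noteq> 0" using y(1) by blast
  have "norm (y w) / x w > 0" using w pos by simp
  then have yu: "norm (y u) / x u > 0" using u(2)[OF w(1)] by linarith
  have "norm k * norm (y u) = norm (\<Sum>v\<in>?V. complex_of_real (ext_adj G u v) * y v)"
    by (simp add: y(2)[OF u(1)] norm_mult)
  also have "\<dots> \<le> (\<Sum>v\<in>?V. ext_adj G u v * norm (y v))"
    by (rule order_trans[OF norm_sum]) (simp add: norm_mult ext_adj_nonneg)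
  also have "\<dots> \<le> (\<Sum>v\<in>?V. ext_adj G u v * (norm (y u) / x u * x v))"
    using u(2) pos by (intro sum_mono mult_left_mono ext_adj_nonneg) (simp add: field_simps)
  also have "\<dots> = norm (y u) / x u * (\<Sum>v\<in>?V. ext_adj G u v * x v)"
    by (simp add: sum_distrib_left mult.left_commute)
  also have "\<dots> < norm (y u) / x u * (l * x u)"
    using less[OF u(1)] yu by (rule mult_strict_left_mono)
  also have "\<dots> = l * norm (y u)" using pos[OF u(1)] by simp
  finally show ?thesis using k(2) by (simp add: mult_less_cancel_right)
qed

section \<open>Numerical inequalities\<close>

text \<open>The matrix entry at an edge whose ends have degrees \<open>a\<close> and
  \<open>b\<close>, with real arguments so that the estimates are free of graphs.\<close>

definition ext_weight :: "real \<Rightarrow> real \<Rightarrow> real" where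
  "ext_weight a b = 1/2 * (a / b + b / a)"

lemma ext_weight_commute: "ext_weight a b = ext_weight b a"
  by (simp add: ext_weight_def)

section \<open>Estimates for degrees at most \<open>n - 3\<close>\<close>

text \<open>The constant \<open>5/3\<close> is the value of \<open>(n + 3) / (n - 3)\<close> at
  \<open>n = 12\<close>, which enters through \<open>sparse_row_bound\<close>. Both sides are
  squared, and the square root in the mixed term is bounded linearly.\<close>

lemma sqrt_bound_sparse:
  fixes n :: real
  assumes n: "n \<ge> 12"
  shows "(n - 3) * sqrt (n - 3) + 5/3 < (n - 0.9) * sqrt (n - 5)"
proof -
  define t where "t = sqrt (n - 3)"
  have t: "t\<^sup>2 = n - 3" "t \<ge> 0" using n by (auto simp: t_def)
  \<comment> \<open>This yields the tangent of the square root at \<open>n = 12\<close>, where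
    \<open>t = 3\<close>.\<close>
  have "0 \<le> (t - 3)\<^sup>2" by simp
  then have t6: "t \<le> (n + 6) / 6" using t(1) by (simp add: power2_eq_square algebra_simps)
  \<comment> \<open>In terms of the distance \<open>e\<close> to the left end of the range, the
    difference of the two sides is a polynomial with positive coefficients. The later estimates use
    the same shift.\<close>
  define e where "e = n - 12"
  have e: "n = 12 + e" "e \<ge> 0" "e * e \<ge> 0" "e * (e * e) \<ge> 0" using n by (auto simp: e_def)
  have "((n - 3) * t + 5/3)\<^sup>2 = (n - 3)\<^sup>2 * t\<^sup>2 + 10/3 * (n - 3) * t + 25/9"
    by (simp add: power2_eq_square field_simps add_nonneg_pos add_pos_nonneg)
  also have "\<dots> \<le> (n - 3)\<^sup>2 * (n - 3) + 10/3 * (n - 3) * ((n + 6) / 6) + 25/9"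
    using t t6 n by (intro add_mono mult_left_mono) auto
  also have "\<dots> < (n - 0.9)\<^sup>2 * (n - 5)"
    using e(2-4) unfolding e(1) by (simp add: power2_eq_square field_simps add_nonneg_pos add_pos_nonneg)
  also have "\<dots> = ((n - 0.9) * sqrt (n - 5))\<^sup>2"
    using n by (simp add: power_mult_distrib)
  finally show ?thesis
    unfolding t_def[symmetric] by (rule power2_less_imp_less) (use n in auto)
qed

text \<open>This is twice the row inequality for the square roots of the degrees. Dividing by
  \<open>sqrt k\<close> turns the left side into \<open>z + (n + 3) * t / z\<close>, which is convex
  in \<open>z\<close> and takes the value \<open>(n - 3) * t + b\<close> at both
  \<open>z = b\<close> and \<open>z = (n - 3) * t\<close>. The relevant \<open>z\<close> lie between
  these two points.\<close>

lemma sparse_row_bound: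
  fixes n k :: real
  assumes n: "n \<ge> 12" and k: "2 \<le> k" "k \<le> n - 3"
  shows "k\<^sup>2 + (n + 3) * sqrt (n - 3) / k < (n - 0.9) * sqrt (n - 5) * sqrt k"
proof -
  define t where "t = sqrt (n - 3)"
  define z where "z = k * sqrt k"
  define b where "b = (n + 3) / (n - 3)"
  have t: "t > 0" "t * t = n - 3" using n by (auto simp: t_def)
  have b: "b \<le> 5/3" "b \<ge> 0" "b * (n - 3) = n + 3" using n by (auto simp: b_def field_simps)
  have z0: "z > 0" using k by (simp add: z_def)
  have "sqrt k \<ge> 1" using k by simp
  then have "z \<ge> 2 * 1" unfolding z_def using k by (intro mult_mono) auto
  moreover have "sqrt k \<le> t" using k by (simp add: t_def)
  then have "z \<le> (n - 3) * t" unfolding z_def using k t by (intro mult_mono) auto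
  ultimately have "(z - b) * (z - (n - 3) * t) \<le> 0"
    using b(1) by (intro mult_nonneg_nonpos) auto
  then have "z * z + (n + 3) * t \<le> ((n - 3) * t + b) * z"
    using b(3) by (simp add: algebra_simps flip: b(3))
  then have "z + (n + 3) * t / z \<le> (n - 3) * t + b"
    using z0 by (simp add: field_simps)
  also have "\<dots> < (n - 0.9) * sqrt (n - 5)"
    using sqrt_bound_sparse[OF n] b(1) by (simp add: t_def)
  finally have "(z + (n + 3) * t / z) * sqrt k < (n - 0.9) * sqrt (n - 5) * sqrt k"
    using k by (intro mult_strict_right_mono) auto
  moreover have "z * sqrt k = k\<^sup>2" using k by (simp add: z_def power2_eq_square)
  moreover have "(n + 3) * t / z * sqrt k = (n + 3) * t / k"
    using k by (simp add: z_def)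
  ultimately show ?thesis by (simp add: t_def distrib_right)
qed

section \<open>Estimates for a center of degree \<open>d = n - 2\<close>\<close>

text \<open>The row inequality at a leaf, divided by the entry at the center. The constant
  \<open>11/100\<close> has to exceed \<open>1 / d\<close>.\<close>

lemma near_star_leaf:
  assumes "(d::real) \<ge> 10"
  shows "ext_weight d 1 < (d + (11/100)) / 2"
  using assms by (simp add: ext_weight_def field_simps)

lemma inverse_le_linear:
  assumes "(d::real) \<ge> 10"
  shows "1 / d \<le> (1/100) * d"
proof -
  have "10 * 10 \<le> d * d" using assms by (intro mult_mono) auto
  then show ?thesis using assms by (simp add: field_simps)
qed

text \<open>The row inequality at a neighbour of the center: the center has entry \<open>L\<close>,
  and the other \<open>k - 1\<close> neighbours have entry \<open>3/10 * d\<close> and degree at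
  most 4. The witnesses for \<open>B\<close> are the values \<open>ext_weight k 1\<close>, the
  largest among these degrees.\<close>

lemma near_star_inner:
  fixes d L :: real and k :: nat
  assumes d: "d \<ge> 10" and L: "L \<ge> (73/5)" and k: "k \<in> {2, 3, 4}"
  shows "\<exists>B. (\<forall>j::nat\<in>{1, 2, 3, 4}. ext_weight k j \<le> B) \<and>
    (real k - 1) * B * ((3/10) * d) + ext_weight d k * L < L * ((3/10) * d)"
proof -
  \<comment> \<open>Replacing \<open>1 / d\<close> by \<open>d / 100\<close> leaves only multiples
    of \<open>d\<close> and \<open>d * L\<close>, so that linear arithmetic applies.\<close>
  define q where "q = 1 / d"
  have q: "0 \<le> q" "q \<le> (1/100) * d" using inverse_le_linear[OF d] d by (auto simp: q_def)
  have qL: "q * L \<le> (1/100) * d * L" using q L by (intro mult_right_mono) auto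
  then have qL': "q * L \<le> (1/100) * (d * L)" by simp
  have dL: "d * (73/5) \<le> d * L" using d L by (intro mult_left_mono) auto
  have w: "ext_weight d k * L = (d * L) / (2 * real k) + real k * (q * L) / 2"
    by (simp add: ext_weight_def q_def algebra_simps)
  have r: "L * ((3/10) * d) = (3/10) * (d * L)" by simp
  from k consider "k = 2" | "k = 3" | "k = 4" by auto
  then show ?thesis
  proof cases
    case 1
    have w': "ext_weight d 2 * L = (d * L) / 4 + q * L" using w by (simp add: 1)
    have "ext_weight d k * L \<le> (13/50) * (d * L)" 
      unfolding 1 of_nat_numeral using w' qL' by linarith
    moreover have "(real k - 1) * (5/4) * ((3/10) * d) = (3/8) * d" by (simp add: 1)
    ultimately have "(real k - 1) * (5/4) * ((3/10) * d) + ext_weight d k * L < L * ((3/10) * d)"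
      using dL d r by linarith
    then show ?thesis
      using 1 by (intro exI[of _ "5/4"]) (simp add: ext_weight_def)
  next
    case 2
    have w': "ext_weight d 3 * L = (d * L) / 6 + 3/2 * (q * L)" using w by (simp add: 2)
    have "ext_weight d k * L \<le> (109/600) * (d * L)" 
      unfolding 2 of_nat_numeral using w' qL' by linarith
    moreover have "(real k - 1) * (5/3) * ((3/10) * d) = 1 * d" by (simp add: 2)
    ultimately have "(real k - 1) * (5/3) * ((3/10) * d) + ext_weight d k * L < L * ((3/10) * d)"
      using dL d r by linarith
    then show ?thesis
      using 2 by (intro exI[of _ "5/3"]) (simp add: ext_weight_def)
  next
    case 3
    have w': "ext_weight d 4 * L = (d * L) / 8 + 2 * (q * L)" using w by (simp add: 3)
    have "ext_weight d k * L \<le> (29/200) * (d * L)" 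
      unfolding 3 of_nat_numeral using w' qL' by linarith
    moreover have "(real k - 1) * (17/8) * ((3/10) * d) = (153/80) * d" by (simp add: 3)
    ultimately have "(real k - 1) * (17/8) * ((3/10) * d) + ext_weight d k * L < L * ((3/10) * d)"
      using dL d r by linarith
    then show ?thesis
      using 3 by (intro exI[of _ "17/8"]) (simp add: ext_weight_def)
  qed
qed

lemma near_star_inner_le:
  fixes d :: real and k :: nat
  assumes d: "d \<ge> 10" and k: "k \<in> {2, 3, 4}"
  shows "ext_weight d k \<le> ext_weight d 2"
  using inverse_le_linear[OF d] d k by (auto simp: ext_weight_def)

text \<open>The row inequality at the center with \<open>m\<close> non-pendant neighbours; the right
  side is the square of the threshold. A leaf contributes at least as much as a non-pendant
  neighbour (\<open>F \<le> E\<close>), so \<open>m = 3\<close> is the worst case. The constant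
  \<open>1011/1000\<close> is \<open>1 + (11/100) / d\<close> at \<open>d = 10\<close>.\<close>

lemma near_star_center:
  fixes d m :: real
  assumes d: "d \<ge> 10" and m: "m \<ge> 3"
  shows "(d - m) * (ext_weight d 1 * ((d + (11/100)) / 2)) + m * (ext_weight d 2 * ((3/10) * d))
    < (d + (11/10))\<^sup>2 * (d - 3) / 4"
proof -
  define E where "E = ext_weight d 1 * ((d + (11/100)) / 2)"
  define F where "F = ext_weight d 2 * ((3/10) * d)"
  have E: "E = (d * d + (11/100) * d + 1 + (11/100) / d) / 4"
    using d by (simp add: E_def ext_weight_def field_simps)
  have F: "F = (3/40) * (d * d) + (3/10)" using d by (simp add: F_def ext_weight_def field_simps)
  have "10 * 10 \<le> d * d" using d by (intro mult_mono) auto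
  moreover define h where "h = (11/100) / d"
  moreover have "h \<ge> 0" using d by (simp add: h_def)
  moreover have "E = (1/4) * (d * d) + (11/400) * d + 1/4 + (1/4) * h" unfolding E h_def by simp
  ultimately have "F \<le> E" unfolding F using d by linarith
  then have "(m - 3) * F \<le> (m - 3) * E" using m by (intro mult_left_mono) auto
  then have "(d - m) * E + m * F \<le> (d - 3) * E + 3 * F" by (simp add: algebra_simps)
  also have "(d - 3) * E \<le> (d - 3) * ((d * d + (11/100) * d + (1011/1000)) / 4)"
    unfolding E using d by (intro mult_left_mono) (auto simp: field_simps)
  finally have "(d - m) * E + m * F \<le> (d - 3) * ((d * d + (11/100) * d + (1011/1000)) / 4) + 3 * F"
    by simp
  also have "\<dots> < (d + (11/10))\<^sup>2 * (d - 3) / 4"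
  proof -
    define e where "e = d - 10"
    have e: "d = 10 + e" "e \<ge> 0" "e * e \<ge> 0" "e * (e * e) \<ge> 0" using d by (auto simp: e_def)
    show ?thesis unfolding F using e(2-4) unfolding e(1)
      by (simp add: power2_eq_square field_simps add_nonneg_pos add_pos_nonneg)
  qed
  finally show ?thesis by (simp add: E_def F_def)
qed

text \<open>With two non-pendant neighbours, weights for degree 2 would violate the bound at
  \<open>d = 10\<close>. In the graphs concerned both have degree 3, which just suffices.\<close>

lemma near_star_center_2:
  fixes d :: real
  assumes d: "d \<ge> 10"
  shows "(d - 2) * (ext_weight d 1 * ((d + (11/100)) / 2)) + 2 * (ext_weight d 3 * ((3/10) * d))
    < (d + (11/10))\<^sup>2 * (d - 3) / 4"
proof -
  define E where "E = ext_weight d 1 * ((d + (11/100)) / 2)"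
  have E: "E = (d * d + (11/100) * d + 1 + (11/100) / d) / 4"
    using d by (simp add: E_def ext_weight_def field_simps)
  have F: "ext_weight d 3 * ((3/10) * d) = (1/20) * (d * d) + (9/20)"
    using d by (simp add: ext_weight_def field_simps)
  have "(d - 2) * E \<le> (d - 2) * ((d * d + (11/100) * d + (1011/1000)) / 4)"
    unfolding E using d by (intro mult_left_mono) (auto simp: field_simps)
  moreover have "(d - 2) * ((d * d + (11/100) * d + (1011/1000)) / 4) + 2 * ((1/20) * (d * d) + (9/20)) < (d + (11/10))\<^sup>2 * (d - 3) / 4"
  proof -
    define e where "e = d - 10"
    have e: "d = 10 + e" "e \<ge> 0" "e * e \<ge> 0" "e * (e * e) \<ge> 0" using d by (auto simp: e_def)
    show ?thesis using e(2-4) unfolding e(1)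
      by (simp add: power2_eq_square field_simps add_nonneg_pos add_pos_nonneg)
  qed
  ultimately show ?thesis unfolding F E_def[symmetric] by linarith
qed

section \<open>Estimates for two triangles sharing a center of degree
  \<open>d = n - 1\<close>\<close>

text \<open>The row inequality at the center. The four triangle vertices get
  \<open>29/100 * d\<close>, because \<open>3/10 * d\<close> would violate the inequality at
  \<open>d = 11\<close>.\<close>

lemma friendship_center:
  fixes d :: real
  assumes d: "d \<ge> 11"
  shows "(d - 4) * (ext_weight d 1 * ((d + (1/10)) / 2)) + 4 * (ext_weight d 2 * ((29/100) * d))
    < (d + (1/10))\<^sup>2 * (d - (14/5)) / 4"
proof -
  define E where "E = ext_weight d 1 * ((d + (1/10)) / 2)"
  have E: "E = (d * d + (1/10) * d + 1 + (1/10) / d) / 4"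
    using d by (simp add: E_def ext_weight_def field_simps)
  have F: "ext_weight d 2 * ((29/100) * d) = (29/400) * (d * d) + (29/100)"
    using d by (simp add: ext_weight_def field_simps)
  have "(d - 4) * E \<le> (d - 4) * ((d * d + (1/10) * d + (101/100)) / 4)"
    unfolding E using d by (intro mult_left_mono) (auto simp: field_simps)
  moreover have "(d - 4) * ((d * d + (1/10) * d + (101/100)) / 4) + 4 * ((29/400) * (d * d) + (29/100)) < (d + (1/10))\<^sup>2 * (d - (14/5)) / 4"
  proof -
    define e where "e = d - 11"
    have e: "d = 11 + e" "e \<ge> 0" "e * e \<ge> 0" "e * (e * e) \<ge> 0" using d by (auto simp: e_def)
    show ?thesis using e(2-4) unfolding e(1)
      by (simp add: power2_eq_square field_simps add_nonneg_pos add_pos_nonneg)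
  qed
  ultimately show ?thesis unfolding F E_def[symmetric] by linarith
qed

lemma friendship_leaf:
  assumes "(d::real) \<ge> 11"
  shows "ext_weight d 1 < (d + (1/10)) / 2"
  using assms by (simp add: ext_weight_def field_simps)

text \<open>The row inequality at a triangle vertex: its other neighbour also has degree 2, so the
  weight between them is 1.\<close>

lemma friendship_inner:
  fixes d L :: real
  assumes d: "d \<ge> 11" and L: "L \<ge> 15"
  shows "ext_weight d 2 * L + (29/100) * d < L * ((29/100) * d)"
proof -
  have "1 / d * L \<le> (1/100) * d * L" using inverse_le_linear[of d] L d by (intro mult_right_mono) auto
  moreover have "ext_weight d 2 * L = (1/4) * (L * d) + 1 / d * L" by (simp add: ext_weight_def algebra_simps)
  moreover have "(1/100) * d * L = (1/100) * (L * d)" "L * ((29/100) * d) = (29/100) * (L * d)" by simp_all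
  moreover have "15 * d \<le> L * d" using d L by (intro mult_right_mono) auto
  ultimately show ?thesis using d by linarith
qed

section \<open>Lower bounds at the centers of \<open>G2\<close> and \<open>G1\<close>\<close>

text \<open>The squared weight is \<open>(a^2 / b^2 + 2 + b^2 / a^2) / 4\<close>. Dropping its last
  summand leaves a polynomial inequality in \<open>d\<close>.\<close>

lemma G2_center_lower:
  fixes d :: real
  assumes d: "d \<ge> 11"
  shows "(d + (1/10))\<^sup>2 * (d - 4) / 4 < (d - 4) * (ext_weight d 1)\<^sup>2 + 4 * (ext_weight d 2)\<^sup>2"
proof -
  have 1: "(ext_weight d 1)\<^sup>2 \<ge> (d * d + 2) / 4" and 2: "(ext_weight d 2)\<^sup>2 \<ge> (d * d / 4 + 2) / 4"
    using d by (auto simp: ext_weight_def power2_eq_square field_simps)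
  have "(d - 4) * ((d * d + 2) / 4) \<le> (d - 4) * (ext_weight d 1)\<^sup>2"
    using 1 d by (intro mult_left_mono) auto
  moreover have "(d + (1/10))\<^sup>2 * (d - 4) / 4 < (d - 4) * ((d * d + 2) / 4) + 4 * ((d * d / 4 + 2) / 4)"
  proof -
    define e where "e = d - 11"
    have e: "d = 11 + e" "e \<ge> 0" "e * e \<ge> 0" "e * (e * e) \<ge> 0" using d by (auto simp: e_def)
    show ?thesis using e(2-4) unfolding e(1)
      by (simp add: power2_eq_square field_simps add_nonneg_pos add_pos_nonneg)
  qed
  ultimately show ?thesis using 2 by linarith
qed

lemma G1_center_lower:
  fixes d :: real
  assumes d: "d \<ge> 11"
  shows "(d + (1/10))\<^sup>2 * (d - (14/5)) / 4 <
    (d - 3) * (ext_weight d 1)\<^sup>2 + 2 * (ext_weight d 2)\<^sup>2 + (ext_weight d 3)\<^sup>2"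
proof -
  have 1: "(ext_weight d 1)\<^sup>2 \<ge> (d * d + 2) / 4" and 2: "(ext_weight d 2)\<^sup>2 \<ge> (d * d / 4 + 2) / 4"
    and 3: "(ext_weight d 3)\<^sup>2 \<ge> (d * d / 9 + 2) / 4"
    using d by (auto simp: ext_weight_def power2_eq_square field_simps)
  have "(d - 3) * ((d * d + 2) / 4) \<le> (d - 3) * (ext_weight d 1)\<^sup>2"
    using 1 d by (intro mult_left_mono) auto
  moreover have "(d + (1/10))\<^sup>2 * (d - (14/5)) / 4 <
    (d - 3) * ((d * d + 2) / 4) + 2 * ((d * d / 4 + 2) / 4) + (d * d / 9 + 2) / 4"
  proof -
    define e where "e = d - 11"
    have e: "d = 11 + e" "e \<ge> 0" "e * e \<ge> 0" "e * (e * e) \<ge> 0" using d by (auto simp: e_def)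
    show ?thesis using e(2-4) unfolding e(1)
      by (simp add: power2_eq_square field_simps add_nonneg_pos add_pos_nonneg)
  qed
  ultimately show ?thesis using 2 3 by linarith
qed

lemma threshold_ge:
  fixes n :: real
  assumes n: "n \<ge> 12"
  shows "1/2 * (n - 0.9) * sqrt (n - 5) \<ge> 14.6" "1/2 * (n - 0.9) * sqrt (n - 3.8) \<ge> 15"
proof -
  have "sqrt (n - 5) \<ge> 2.64" "sqrt (n - 3.8) \<ge> 2.8"
    using n by (intro real_le_rsqrt, simp add: power2_eq_square)+
  then have "1/2 * (n - 0.9) * sqrt (n - 5) \<ge> 1/2 * 11.1 * 2.64"
    "1/2 * (n - 0.9) * sqrt (n - 3.8) \<ge> 1/2 * 11.1 * 2.8"
    by (intro mult_mono; use n in simp)+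
  then show "1/2 * (n - 0.9) * sqrt (n - 5) \<ge> 14.6" "1/2 * (n - 0.9) * sqrt (n - 3.8) \<ge> 15"
    by auto
qed

lemma threshold_square:
  assumes "(a::real) \<ge> 0" "b \<ge> 0"
  shows "(1/2 * a * sqrt b)\<^sup>2 = a\<^sup>2 * b / 4"
  using assms by (simp add: power_mult_distrib power_divide)

section \<open>Degrees in bicyclic graphs\<close>

lemma deg_eq_card: "finite (parcs G) \<Longrightarrow> deg G u = card (parcs G `` {u})"
proof -
  have "{a \<in> parcs G. fst a = u} = Pair u ` (parcs G `` {u})" by auto
  then show "deg G u = card (parcs G `` {u})"
    by (simp add: deg_def out_degree_def out_arcs_def card_image inj_on_def)
qed

text \<open>Every unordered pair in the image has two preimages: symmetry supplies both orientations
  and irreflexivity makes them distinct.\<close>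

lemma card_sym_irrefl_rel:
  assumes "finite R" "sym R" "irrefl R"
  shows "card R = 2 * card ((\<lambda>(u, v). {u, v}) ` R)"
proof -
  let ?f = "\<lambda>(u, v). {u, v}"
  have "card R = (\<Sum>e\<in>?f ` R. card {p \<in> R. ?f p = e})"
    using sum.image_gen[OF assms(1), of "\<lambda>_. 1::nat" ?f] by simp
  also have "\<dots> = (\<Sum>e\<in>?f ` R. 2)"
  proof (rule sum.cong[OF refl])
    fix e assume "e \<in> ?f ` R"
    then obtain u v where e: "e = {u, v}" "(u, v) \<in> R" by auto
    then have "u \<noteq> v" "(v, u) \<in> R" using assms by (auto simp: irrefl_def sym_def)
    then have "{p \<in> R. ?f p = e} = {(u, v), (v, u)}" using e by (auto simp: doubleton_eq_iff)
    then show "card {p \<in> R. ?f p = e} = 2" using \<open>u \<noteq> v\<close> by simp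
  qed
  finally show ?thesis by simp
qed

locale bicyclic_graph =
  fixes G :: "'a pair_pre_digraph" and n :: nat
  assumes bicyclic: "bicyclic G" and order: "card (pverts G) = n" and n12: "n \<ge> 12"
begin

abbreviation "V \<equiv> pverts G"
abbreviation "N u \<equiv> parcs G `` {u}"

lemma pair_graph: "pair_graph G"
  using bicyclic by (simp add: bicyclic_def)

lemma finite_verts: "finite V" and finite_arcs: "finite (parcs G)"
proof -
  interpret pair_graph G by (rule pair_graph)
  show "finite V" by (rule pair_finite_verts)
  show "finite (parcs G)" by (rule pair_finite_arcs)
qed

lemma arc_sym: "(u, v) \<in> parcs G \<Longrightarrow> (v, u) \<in> parcs G"
proof -
  interpret pair_graph G by (rule pair_graph)
  show "(u, v) \<in> parcs G \<Longrightarrow> (v, u) \<in> parcs G" by (rule arcs_symmetric)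
qed

lemma arc_irrefl: "(u, u) \<notin> parcs G"
proof -
  interpret pair_graph G by (rule pair_graph)
  show ?thesis using pair_no_loops[of "(u, u)"] by auto
qed

lemma arc_verts: "(u, v) \<in> parcs G \<Longrightarrow> u \<in> V \<and> v \<in> V"
proof -
  interpret pair_graph G by (rule pair_graph)
  show "(u, v) \<in> parcs G \<Longrightarrow> u \<in> V \<and> v \<in> V" using in_arcsD1 in_arcsD2 by blast
qed

lemma card_arcs: "card (parcs G) = 2 * n + 2"
  using card_sym_irrefl_rel[OF finite_arcs] bicyclic order arc_sym arc_irrefl
  by (auto simp: bicyclic_def edges_def sym_def irrefl_def)

lemma finite_nbrs: "finite (N u)"
  using finite_arcs by (rule finite_Image)

lemma nbrs_subset: "N u \<subseteq> V - {u}"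
  using arc_verts arc_irrefl by auto

lemma deg_eq: "deg G u = card (N u)"
  by (rule deg_eq_card[OF finite_arcs])

lemma sum_deg: "(\<Sum>u\<in>V. deg G u) = 2 * n + 2"
proof -
  have "parcs G = (SIGMA u:V. N u)" using arc_verts by auto
  then have "card (parcs G) = (\<Sum>u\<in>V. card (N u))"
    using card_SigmaI[OF finite_verts, of N] finite_nbrs by simp
  then show ?thesis using card_arcs by (simp add: deg_eq)
qed

text \<open>In a symmetric digraph connectedness is strong connectedness, and a walk to some other
  vertex has to leave \<open>u\<close>.\<close>

lemma deg_pos: "u \<in> V \<Longrightarrow> deg G u \<ge> 1"
proof -
  assume u: "u \<in> V"
  have "card V > card {u}" using order n12 by simp
  then have "\<not> V \<subseteq> {u}" using card_mono[of "{u}" V] by auto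
  then obtain v where v: "v \<in> V" "v \<noteq> u" by auto
  interpret pair_graph G by (rule pair_graph)
  have "Digraph_Component.connected (with_proj G)" using bicyclic by (simp add: bicyclic_def)
  then have "strongly_connected (with_proj G)"
    by (rule symmetric_connected_imp_strongly_connected[OF pair_sym_arcs])
  then have "u \<rightarrow>\<^sup>*\<^bsub>with_proj G\<^esub> v" using u v by (auto simp: strongly_connected_def)
  then obtain w where "(u, w) \<in> parcs G"
    using v(2) by (auto elim: converse_reachable_cases)
  then have "N u \<noteq> {}" by auto
  then show ?thesis using finite_nbrs by (simp add: deg_eq Suc_le_eq card_gt_0_iff)
qed

lemma deg_le: "u \<in> V \<Longrightarrow> deg G u \<le> n - 1"
  using card_mono[of "V - {u}" "N u"] nbrs_subset finite_verts order by (simp add: deg_eq)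

lemma sum_ext_adj:
  "(\<Sum>v\<in>V. ext_adj G u v * x v) = (\<Sum>v\<in>N u. ext_weight (deg G u) (deg G v) * x v)"
proof -
  have "(\<Sum>v\<in>V. ext_adj G u v * x v) = (\<Sum>v\<in>N u. ext_adj G u v * x v)"
    using finite_verts nbrs_subset by (intro sum.mono_neutral_right) (auto simp: ext_adj_def)
  then show ?thesis by (auto simp: ext_adj_def ext_weight_def intro!: sum.cong)
qed

text \<open>Of the total \<open>2 * n + 2\<close>, the vertex \<open>u\<close> takes its own degree,
  and each of the \<open>n - 1 - deg G u\<close> vertices not adjacent to it takes at least 1. The
  degree of \<open>u\<close> cancels.\<close>

lemma nbr_deg_sum: "u \<in> V \<Longrightarrow> (\<Sum>v\<in>N u. deg G v) \<le> n + 3"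
proof -
  assume u: "u \<in> V"
  have "2 * n + 2 = (\<Sum>v\<in>N u. deg G v) + (\<Sum>v\<in>V - {u} - N u. deg G v) + deg G u"
    using sum_deg sum.remove[OF finite_verts u, of "deg G"]
      sum.subset_diff[OF nbrs_subset[of u], of "deg G"] finite_verts by simp
  moreover have "(\<Sum>v\<in>V - {u} - N u. deg G v) \<ge> (\<Sum>v\<in>V - {u} - N u. 1)"
    using deg_pos by (intro sum_mono) auto
  moreover have "(\<Sum>v\<in>V - {u} - N u. 1) = n - 1 - deg G u"
    using u order finite_verts nbrs_subset[of u] by (simp add: deg_eq card_Diff_subset finite_nbrs)
  moreover have "deg G u \<le> n - 1" using u by (rule deg_le)
  ultimately show ?thesis using n12 by simp
qed

lemma rho_ex_less':
  assumes "\<And>u. u \<in> V \<Longrightarrow> x u > 0"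
    and "\<And>u. u \<in> V \<Longrightarrow> (\<Sum>v\<in>N u. ext_weight (deg G u) (deg G v) * x v) < l * x u"
  shows "rho_ex G < l"
proof (rule rho_ex_less)
  show "V \<noteq> {}" using order n12 by auto
qed (use assms finite_verts in \<open>auto simp: sum_ext_adj\<close>)

end

section \<open>Graphs without a dominating vertex\<close>

context bicyclic_graph
begin

text \<open>For the square roots of the degrees, the two summands of a weighted entry are bounded by
  degree at least 1 and degree at most \<open>n - 3\<close>, respectively. The row sum then depends
  only on \<open>k\<close> and the sum of the neighbouring degrees.\<close>

lemma rho_ex_less_if_sparse:
  assumes sparse: "\<And>u. u \<in> V \<Longrightarrow> deg G u \<le> n - 3"
  shows "rho_ex G < 1/2 * (real n - 0.9) * sqrt (real n - 5)"
proof (rule rho_ex_less'[where x = "\<lambda>v. sqrt (real (deg G v))"])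
  fix u assume u: "u \<in> V"
  show "sqrt (real (deg G u)) > 0" using deg_pos[OF u] by simp
  define t where "t = sqrt (real n - 3)"
  define k where "k = real (deg G u)"
  have n: "real n \<ge> 12" using n12 by simp
  have t: "t \<ge> 0" using n by (simp add: t_def)
  have k: "k \<ge> 1" "k \<le> real n - 3" using deg_pos[OF u] sparse[OF u] n12 by (auto simp: k_def)
  have entry: "ext_weight k (deg G v) * sqrt (deg G v) \<le> (k + deg G v * t / k) / 2" if "v \<in> N u" for v
  proof -
    define b where "b = real (deg G v)"
    have v: "v \<in> V" using that arc_verts by auto
    have b: "b \<ge> 1" "b \<le> real n - 3" using deg_pos[OF v] sparse[OF v] n12 by (auto simp: b_def)
    have "ext_weight k b * sqrt b = (k * (sqrt b / b) + b * sqrt b / k) / 2"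
      by (simp add: ext_weight_def algebra_simps)
    also have "sqrt b / b = 1 / sqrt b" using b by (simp add: sqrt_divide_self_eq inverse_eq_divide)
    also have "(k * (1 / sqrt b) + b * sqrt b / k) / 2 \<le> (k * 1 + b * t / k) / 2"
      using b k by (intro divide_right_mono add_mono mult_left_mono) (auto simp: t_def)
    finally show ?thesis by (simp add: b_def)
  qed
  have "(\<Sum>v\<in>N u. ext_weight k (deg G v) * sqrt (deg G v)) \<le> (\<Sum>v\<in>N u. (k + deg G v * t / k) / 2)"
    by (intro sum_mono entry)
  also have "\<dots> = (k * k + real (\<Sum>v\<in>N u. deg G v) * t / k) / 2"
    by (simp add: sum.distrib k_def deg_eq sum_divide_distrib[symmetric] sum_distrib_right[symmetric])
  also have "\<dots> < 1/2 * (real n - 0.9) * sqrt (real n - 5) * sqrt k"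
  \<comment> \<open>The general row bound starts at \<open>k = 2\<close>. At a leaf, the degree sum
    is the degree of a single neighbour, hence at most \<open>n - 3\<close> instead of
    \<open>n + 3\<close>.\<close>
  proof (cases "k = 1")
    case True
    then obtain v where v: "N u = {v}" unfolding k_def deg_eq by (auto simp: card_1_singleton_iff)
    then have "v \<in> V" using arc_verts by auto
    then have "real (deg G v) \<le> real n - 3" using sparse[of v] n12 by linarith
    then have "real (deg G v) * t \<le> (real n - 3) * t" using t by (rule mult_right_mono)
    then show ?thesis using True v sqrt_bound_sparse[OF n] unfolding t_def by simp
  next
    case False
    then have "deg G u \<ge> 2" using deg_pos[OF u] by (simp add: k_def)
    then have k2: "k \<ge> 2" by (simp add: k_def)
    have "real (\<Sum>v\<in>N u. deg G v) \<le> real n + 3" using nbr_deg_sum[OF u] by linarith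
    then have "real (\<Sum>v\<in>N u. deg G v) * t / k \<le> (real n + 3) * t / k"
      using t k by (intro divide_right_mono mult_right_mono) auto
    then have "k * k + real (\<Sum>v\<in>N u. deg G v) * t / k < (real n - 0.9) * sqrt (real n - 5) * sqrt k"
      using sparse_row_bound[OF n k2 k(2)] unfolding t_def power2_eq_square by linarith
    moreover have "p / 2 < 1/2 * q * r * s" if "p < q * r * s" for p q r s :: real
      using that by simp
    ultimately show ?thesis by blast
  qed
  finally show "(\<Sum>v\<in>N u. ext_weight (deg G u) (deg G v) * sqrt (deg G v)) <
      1/2 * (real n - 0.9) * sqrt (real n - 5) * sqrt (deg G u)"
    unfolding k_def .
qed

section \<open>Degrees after deleting a vertex\<close>

definition deg_off :: "'a \<Rightarrow> 'a \<Rightarrow> nat" where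
  "deg_off c v = card (N v - {c})"

lemma deg_conv_deg_off: "deg G v = deg_off c v + (if v \<in> N c then 1 else 0)"
proof (cases "v \<in> N c")
  case True
  then have "c \<in> N v" using arc_sym by auto
  then show ?thesis using True card_Suc_Diff1[OF finite_nbrs] by (simp add: deg_eq deg_off_def)
next
  case False
  then have "c \<notin> N v" using arc_sym by auto
  then show ?thesis using False by (simp add: deg_eq deg_off_def)
qed

text \<open>The handshake lemma without \<open>c\<close>: the sum is twice the number of edges
  avoiding \<open>c\<close>, namely 6 if \<open>c\<close> has degree \<open>n - 2\<close> and 4 if
  it dominates.\<close>

lemma sum_deg_off:
  assumes c: "c \<in> V"
  shows "(\<Sum>v\<in>V - {c}. deg_off c v) + 2 * deg G c = 2 * n + 2"
proof -
  have "(\<Sum>v\<in>V - {c}. deg G v) =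
      (\<Sum>v\<in>V - {c}. deg_off c v) + (\<Sum>v\<in>V - {c}. if v \<in> N c then 1 else 0)"
    unfolding sum.distrib[symmetric] by (intro sum.cong refl deg_conv_deg_off)
  also have "(\<Sum>v\<in>V - {c}. if v \<in> N c then 1 else 0) = (\<Sum>v\<in>N c. 1::nat)"
    using finite_verts nbrs_subset[of c] by (intro sum.mono_neutral_cong_right) auto
  also have "\<dots> = deg G c" by (simp add: deg_eq)
  finally show ?thesis using sum_deg sum.remove[OF finite_verts c, of "deg G"] by simp
qed

lemma deg_off_pos:
  assumes "(v, y) \<in> parcs G" "v \<noteq> c"
  shows "deg_off c y \<ge> 1"
proof -
  have "v \<in> N y - {c}" using assms arc_sym by auto
  then show ?thesis using finite_nbrs[of y] by (auto simp: deg_off_def Suc_le_eq card_gt_0_iff)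
qed

lemma deg_off_nbrs_le:
  assumes v: "v \<in> V - {c}"
  shows "deg_off c v + (\<Sum>y\<in>N v - {c}. deg_off c y) \<le> (\<Sum>y\<in>V - {c}. deg_off c y)"
proof -
  have "insert v (N v - {c}) \<subseteq> V - {c}" "v \<notin> N v - {c}"
    using v nbrs_subset[of v] by auto
  then show ?thesis
    using sum_mono2[of "V - {c}" "insert v (N v - {c})" "deg_off c"] finite_verts finite_nbrs[of v]
    by simp
qed

text \<open>The neighbours of \<open>v\<close> other than \<open>c\<close> together have at least
  the degree of \<open>v\<close>, as each keeps its edge to \<open>v\<close>.\<close>

lemma deg_off_le:
  assumes v: "v \<in> V - {c}"
  shows "2 * deg_off c v \<le> (\<Sum>y\<in>V - {c}. deg_off c y)"
proof -
  have "(\<Sum>y\<in>N v - {c}. 1) \<le> (\<Sum>y\<in>N v - {c}. deg_off c y)"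
    using v deg_off_pos by (intro sum_mono) auto
  then show ?thesis using deg_off_nbrs_le[OF v] by (simp add: deg_off_def)
qed

text \<open>One vertex \<open>u\<close> is not adjacent to \<open>c\<close>, and three edges avoid
  \<open>c\<close>; their ends lie in \<open>u\<close> together with the set \<open>M\<close> of
  non-pendant neighbours of \<open>c\<close>. Hence all degrees except that of \<open>c\<close> are
  at most 4. The test vector distinguishes only the center, the leaves at the center and the
  remaining vertices.\<close>

lemma rho_ex_less_if_near_star:
  assumes c: "c \<in> V" "deg G c = n - 2"
  shows "rho_ex G < 1/2 * (real n - 0.9) * sqrt (real n - 5)"
proof -
  define d where "d = real n - 2"
  define L where "L = 1/2 * (real n - 0.9) * sqrt (real n - 5)"
  have d: "d \<ge> 10" "real (deg G c) = d" using n12 c(2) by (auto simp: d_def)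
  have L: "L \<ge> 14.6" using threshold_ge(1)[of n] n12 by (simp add: L_def)
  have L2: "L * L = (d + 11/10)\<^sup>2 * (d - 3) / 4"
  proof -
    have eqs: "d + 11/10 = real n - 0.9" "d - 3 = real n - 5" by (simp_all add: d_def)
    show ?thesis
      using threshold_square[of "real n - 0.9" "real n - 5"] n12
      unfolding L_def[symmetric] power2_eq_square[of L] eqs by simp
  qed
  have total: "(\<Sum>v\<in>V - {c}. deg_off c v) = 6"
    using sum_deg_off[OF c(1)] c(2) n12 by simp
  have "card (V - {c} - N c) = 1"
    using c nbrs_subset[of c] finite_verts order n12 by (simp add: card_Diff_subset finite_nbrs deg_eq)
  then obtain u where u: "V - {c} - N c = {u}" by (auto simp: card_1_singleton_iff)
  have Vc: "V - {c} = insert u (N c)" and uN: "u \<notin> N c" and uV: "u \<in> V - {c}"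
    using u nbrs_subset[of c] by auto
  have off3: "deg_off c v \<le> 3" if "v \<in> V - {c}" for v
    using deg_off_le[OF that] total by simp
  have degN: "deg G v = deg_off c v + 1" if "v \<in> N c" for v
    using deg_conv_deg_off[of v c] that by simp
  have degu: "deg G u = deg_off c u" using deg_conv_deg_off[of u c] uN by simp
  have deg4: "deg G v \<in> {1, 2, 3, 4}" if v: "v \<in> V - {c}" for v
  proof -
    have "deg G v \<le> 4" using deg_conv_deg_off[of v c] off3[OF v] by simp
    moreover have "deg G v \<ge> 1" using v deg_pos by simp
    ultimately show ?thesis by auto
  qed
  define M where "M = {v \<in> N c. deg G v \<noteq> 1}"
  have M: "M \<subseteq> N c" by (auto simp: M_def)
  moreover have "finite M" using finite_subset[OF M finite_nbrs] .
  ultimately have M: "M \<subseteq> N c" "finite M" .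
  have deg_M: "deg G v \<in> {2, 3, 4}" if "v \<in> M" for v
    using deg4[of v] that nbrs_subset[of c] by (auto simp: M_def)
  have nbr_M: "y \<in> insert u M" if "(v, y) \<in> parcs G" "v \<noteq> c" "y \<noteq> c" for v y
  proof (cases "y = u")
    case False
    have "y \<in> V - {c}" using that arc_verts by auto
    then have "y \<in> N c" using False Vc by auto
    then show ?thesis using deg_off_pos[OF that(1,2)] degN[of y] by (auto simp: M_def)
  qed simp
  have Nu: "N u \<subseteq> M"
  proof
    fix y assume y: "y \<in> N u"
    have "y \<noteq> c" using y uN arc_sym by auto
    then show "y \<in> M" using nbr_M[of u y] y uV arc_irrefl by auto
  qed
  have "(\<Sum>v\<in>N c. deg_off c v) = (\<Sum>v\<in>M. deg_off c v)"
    using degN finite_nbrs M by (intro sum.mono_neutral_right) (auto simp: M_def)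
  then have sumM: "(\<Sum>v\<in>M. deg_off c v) + deg G u = 6"
    using total uN finite_nbrs[of c] degu unfolding Vc by simp
  have u_le: "deg G u \<le> card M" using card_mono[OF M(2) Nu] by (simp add: deg_eq)
  have M_le: "deg_off c v \<le> card M" if v: "v \<in> M" for v
  proof -
    have vc: "v \<noteq> c" using v M nbrs_subset[of c] by auto
    have "N v - {c} \<subseteq> insert u (M - {v})"
      using nbr_M[of v] vc arc_irrefl[of v] by auto
    then have "deg_off c v \<le> card (insert u (M - {v}))"
      unfolding deg_off_def using M(2) by (intro card_mono) auto
    also have "\<dots> \<le> Suc (card (M - {v}))" using M(2) by (simp add: card_insert_le_m1 card_insert_if)
    also have "\<dots> = card M" using card_Suc_Diff1[OF M(2) v] by simp
    finally show ?thesis .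
  qed
  have sumM_le: "(\<Sum>v\<in>M. deg_off c v) \<le> card M * card M"
    using sum_bounded_above[of M "deg_off c" "card M"] M_le by simp
  \<comment> \<open>In the star around \<open>c\<close> the entry at a leaf is about \<open>d / 2\<close> when the entry at \<open>c\<close> is \<open>L\<close>; the slack
    is chosen to cover \<open>n = 12\<close>, where the bound at \<open>c\<close> holds only narrowly if \<open>M\<close> has two elements.\<close>
  define x where "x v = (if v = c then L else if v \<in> N c \<and> deg G v = 1 then (d + 11/100) / 2 else 3/10 * d)" for v
  have center: "(\<Sum>v\<in>N c. ext_weight d (deg G v) * x v) < L * L"
  proof -
    have "(\<Sum>v\<in>N c. ext_weight d (deg G v) * x v) =
        (\<Sum>v\<in>N c - M. ext_weight d (deg G v) * x v) + (\<Sum>v\<in>M. ext_weight d (deg G v) * x v)"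
      by (rule sum.subset_diff[OF M(1) finite_nbrs])
    also have "(\<Sum>v\<in>N c - M. ext_weight d (deg G v) * x v) =
        (\<Sum>v\<in>N c - M. ext_weight d 1 * ((d + 11/100) / 2))"
      using nbrs_subset[of c] by (intro sum.cong) (auto simp: M_def x_def)
    also have "\<dots> = (d - card M) * (ext_weight d 1 * ((d + 11/100) / 2))"
    proof -
      have "card M \<le> card (N c)" using M finite_nbrs by (intro card_mono) auto
      then have "real (card (N c - M)) = d - card M"
        using M d(2) by (simp add: card_Diff_subset deg_eq of_nat_diff)
      then show ?thesis by simp
    qed
    also have "(\<Sum>v\<in>M. ext_weight d (deg G v) * x v) = (\<Sum>v\<in>M. ext_weight d (deg G v) * (3/10 * d))"
      using nbrs_subset[of c] by (intro sum.cong) (auto simp: M_def x_def)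
    finally have sum_eq: "(\<Sum>v\<in>N c. ext_weight d (deg G v) * x v) =
      (d - card M) * (ext_weight d 1 * ((d + 11/100) / 2)) + (\<Sum>v\<in>M. ext_weight d (deg G v) * (3/10 * d))" .
    show ?thesis
    proof (cases "card M \<ge> 3")
      case True
      have "(\<Sum>v\<in>M. ext_weight d (deg G v) * (3/10 * d)) \<le> (\<Sum>v\<in>M. ext_weight d 2 * (3/10 * d))"
        using near_star_inner_le[OF d(1) deg_M] d(1) by (intro sum_mono mult_right_mono) auto
      then have "(\<Sum>v\<in>M. ext_weight d (deg G v) * (3/10 * d)) \<le> card M * (ext_weight d 2 * (3/10 * d))" by simp
      then show ?thesis using near_star_center[OF d(1), of "card M"] True unfolding sum_eq L2 by linarith
    next
      case False
      \<comment> \<open>With at most one vertex in \<open>M\<close>, the degrees in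
        \<open>sumM\<close> add up to at most 2 instead of 6.\<close>
      have "\<not> card M \<le> 1"
      proof
        assume "card M \<le> 1"
        moreover from this have "card M * card M \<le> 1 * 1" by (intro mult_le_mono)
        ultimately show False using sumM sumM_le u_le by linarith
      qed
      then have m: "card M = 2" using False by simp
      \<comment> \<open>The three degrees counted by \<open>sumM\<close> are at most 2 and add up to
        6, so all equal 2: the edges avoiding \<open>c\<close> form a triangle through
        \<open>u\<close>.\<close>
      have "deg_off c v = 2" if v: "v \<in> M" for v
      proof (rule ccontr)
        assume "deg_off c v \<noteq> 2"
        then have "deg_off c v < 2" using M_le[OF v] m by simp
        then have "(\<Sum>v\<in>M. deg_off c v) < (\<Sum>v\<in>M. 2)"
          using M_le m v M(2) by (intro sum_strict_mono_ex1) auto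
        then show False using sumM u_le m by simp
      qed
      then have "(\<Sum>v\<in>M. ext_weight d (deg G v) * (3/10 * d)) = (\<Sum>v\<in>M. ext_weight d 3 * (3/10 * d))"
        using degN M(1) by (intro sum.cong) auto
      also have "\<dots> = 2 * (ext_weight d 3 * (3/10 * d))" using m by simp
      finally show ?thesis using near_star_center_2[OF d(1)] unfolding sum_eq L2 m by simp
    qed
  qed
  have x_inner: "x y = 3/10 * d" if "y \<in> insert u M" for y
    using that uN uV M(1) nbrs_subset[of c] by (auto simp: x_def M_def)
  have "(\<Sum>y\<in>N v. ext_weight (deg G v) (deg G y) * x y) < L * x v" if v: "v \<in> V" for v
  proof -
    consider "v = c" | "v \<in> N c - M" | "v \<in> M" | "v = u" using v Vc by auto
    then show ?thesis
    proof cases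
      case 1
      then show ?thesis using center d(2) by (simp add: x_def)
    next
      case 2
      have "c \<in> N v" using 2 arc_sym by auto
      moreover have "card (N v) = 1" using 2 by (simp add: M_def deg_eq)
      ultimately have Nv: "N v = {c}" by (metis card_1_singletonE singletonD)
      have "ext_weight 1 d * L < L * ((d + 11/100) / 2)"
        unfolding mult.commute[of L]
        using near_star_leaf[OF d(1)] L by (intro mult_strict_right_mono) (auto simp: ext_weight_def)
      then show ?thesis using 2 Nv d(2) nbrs_subset[of c] by (auto simp: x_def M_def)
    next
      case 3
      have vc: "v \<noteq> c" using 3 M nbrs_subset[of c] by auto
      have cN: "c \<in> N v" using 3 M arc_sym by auto
      obtain B where B: "\<forall>j::nat\<in>{1, 2, 3, 4}. ext_weight (deg G v) j \<le> B"
        "(real (deg G v) - 1) * B * (3/10 * d) + ext_weight d (deg G v) * L < L * (3/10 * d)"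
        using near_star_inner[OF d(1), of L "deg G v"] L deg_M[OF 3] by auto
      have "(\<Sum>y\<in>N v. ext_weight (deg G v) (deg G y) * x y) =
          ext_weight (deg G v) d * L + (\<Sum>y\<in>N v - {c}. ext_weight (deg G v) (deg G y) * x y)"
        using sum.remove[OF finite_nbrs cN, of "\<lambda>y. ext_weight (deg G v) (deg G y) * x y"] d(2)
        by (simp add: x_def)
      also have "(\<Sum>y\<in>N v - {c}. ext_weight (deg G v) (deg G y) * x y) \<le> (\<Sum>y\<in>N v - {c}. B * (3/10 * d))"
      proof (rule sum_mono)
        fix y assume y: "y \<in> N v - {c}"
        then have "y \<in> V - {c}" "y \<in> insert u M" using nbr_M[of v y] vc arc_verts by auto
        then have le: "ext_weight (deg G v) (deg G y) \<le> B" and xy: "x y = 3/10 * d"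
          using deg4[of y] B(1) x_inner[of y] by auto
        show "ext_weight (deg G v) (deg G y) * x y \<le> B * (3/10 * d)"
          unfolding xy using le d(1) by (intro mult_right_mono) auto
      qed
      also have "\<dots> = (real (deg G v) - 1) * B * (3/10 * d)"
        using degN[of v] 3 M(1) by (auto simp: deg_off_def)
      finally have "(\<Sum>y\<in>N v. ext_weight (deg G v) (deg G y) * x y) < L * (3/10 * d)"
        using B(2) unfolding ext_weight_commute[of "deg G v" d] by linarith
      moreover have "x v = 3/10 * d" using x_inner[of v] 3 by simp
      ultimately show ?thesis by presburger
    next
      case 4
      \<comment> \<open>At most three neighbours, each with weight at most \<open>17/8\<close>
        (degrees 1 and 4), give a factor \<open>51/8\<close>, well below \<open>L\<close>; the
        entries on both sides agree.\<close>
      have "(\<Sum>y\<in>N u. ext_weight (deg G u) (deg G y) * x y) \<le> (\<Sum>y\<in>N u. 17/8 * (3/10 * d))"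
      proof (rule sum_mono)
        fix y assume y: "y \<in> N u"
        then have yM: "y \<in> M" using Nu by auto
        have "deg G u \<in> {1, 2, 3, 4}" "deg G y \<in> {2, 3, 4}" using deg4[OF uV] deg_M[OF yM] by auto
        then have "ext_weight (deg G u) (deg G y) \<le> 17/8" by (auto simp: ext_weight_def)
        then show "ext_weight (deg G u) (deg G y) * x y \<le> 17/8 * (3/10 * d)"
          using x_inner[of y] yM d(1) by (intro mult_mono) auto
      qed
      also have "\<dots> = real (deg G u) * (17/8 * (3/10 * d))" by (simp add: deg_eq)
      also have "\<dots> \<le> 3 * (17/8 * (3/10 * d))"
        using off3[OF uV] d(1) unfolding degu by (intro mult_right_mono) auto
      also have "\<dots> < 14 * (3/10 * d)" using d(1) by simp
      also have "\<dots> \<le> L * (3/10 * d)" using L d(1) by (intro mult_right_mono) auto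
      finally have "(\<Sum>y\<in>N u. ext_weight (deg G u) (deg G y) * x y) < L * (3/10 * d)" .
      moreover have "x u = 3/10 * d" using x_inner[of u] by simp
      ultimately show ?thesis using 4 by presburger
    qed
  qed
  moreover have "x v > 0" for v using d(1) L by (simp add: x_def)
  ultimately have "rho_ex G < L" by (intro rho_ex_less'[where x = x]) auto
  then show ?thesis by (simp add: L_def)
qed

end

section \<open>Graphs with a dominating vertex\<close>

context bicyclic_graph
begin

section \<open>A dominating vertex and two disjoint edges avoiding it\<close>

text \<open>The degrees without \<open>c\<close> are at most 1 and add up to 4, so there are four
  vertices of degree 2 and the rest are leaves. Stating this through \<open>deg_off\<close> covers
  all copies of \<open>G2\<close> at once.\<close>

lemma rho_ex_less_if_friendship:
  assumes c: "c \<in> V" "deg G c = n - 1" and off: "\<And>v. v \<in> V - {c} \<Longrightarrow> deg_off c v \<le> 1"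
  shows "rho_ex G < 1/2 * (real n - 0.9) * sqrt (real n - 3.8)"
proof -
  define d where "d = real n - 1"
  define L where "L = 1/2 * (real n - 0.9) * sqrt (real n - 3.8)"
  have d: "d \<ge> 11" "real (deg G c) = d" using n12 c(2) by (auto simp: d_def)
  have L: "L \<ge> 15" using threshold_ge(2)[of n] n12 by (simp add: L_def)
  have L2: "L * L = (d + 1/10)\<^sup>2 * (d - 14/5) / 4"
  proof -
    have eqs: "d + 1/10 = real n - 0.9" "d - 14/5 = real n - 3.8" by (simp_all add: d_def)
    show ?thesis
      using threshold_square[of "real n - 0.9" "real n - 3.8"] n12
      unfolding L_def[symmetric] power2_eq_square[of L] eqs by simp
  qed
  have Nc: "N c = V - {c}"
    using nbrs_subset[of c] c finite_verts order by (intro card_subset_eq) (auto simp: deg_eq)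
  have degV: "deg G v = deg_off c v + 1" if "v \<in> V - {c}" for v
    using deg_conv_deg_off[of v c] that Nc by simp
  define M where "M = {v \<in> V - {c}. deg_off c v = 1}"
  have M: "M \<subseteq> V - {c}" "finite M" using finite_verts by (auto simp: M_def)
  have "(\<Sum>v\<in>V - {c}. deg_off c v) = (\<Sum>v\<in>M. 1)"
  proof (intro sum.mono_neutral_cong_right ballI)
    fix v assume "v \<in> V - {c} - M"
    then show "deg_off c v = 0" using off[of v] by (auto simp: M_def)
  qed (use finite_verts in \<open>auto simp: M_def\<close>)
  then have cM: "card M = 4" using sum_deg_off[OF c(1)] c(2) n12 by simp
  define x where "x v = (if v = c then L else if v \<in> M then 29/100 * d else (d + 1/10) / 2)" for v
  have deg_M: "deg G v = 2" if "v \<in> M" for v using degV[of v] that by (auto simp: M_def)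
  have deg_leaf: "deg G v = 1" if "v \<in> V - {c} - M" for v
    using degV[of v] off[of v] that by (auto simp: M_def)
  have center: "(\<Sum>v\<in>N c. ext_weight d (deg G v) * x v) < L * L"
  proof -
    have "(\<Sum>v\<in>N c. ext_weight d (deg G v) * x v) =
        (\<Sum>v\<in>N c - M. ext_weight d (deg G v) * x v) + (\<Sum>v\<in>M. ext_weight d (deg G v) * x v)"
      using M Nc finite_verts by (intro sum.subset_diff) auto
    also have "(\<Sum>v\<in>N c - M. ext_weight d (deg G v) * x v) =
        (\<Sum>v\<in>N c - M. ext_weight d 1 * ((d + 1/10) / 2))"
      using deg_leaf Nc by (intro sum.cong) (auto simp: x_def)
    also have "\<dots> = (d - 4) * (ext_weight d 1 * ((d + 1/10) / 2))"
    proof -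
      have "card (N c - M) = deg G c - 4"
        using M Nc cM by (simp add: card_Diff_subset deg_eq)
      then have "real (card (N c - M)) = d - 4" using d by simp
      then show ?thesis by simp
    qed
    also have "(\<Sum>v\<in>M. ext_weight d (deg G v) * x v) = (\<Sum>v\<in>M. ext_weight d 2 * (29/100 * d))"
      using deg_M M(1) by (intro sum.cong) (auto simp: x_def)
    also have "\<dots> = 4 * (ext_weight d 2 * (29/100 * d))" using cM by simp
    finally show ?thesis using friendship_center[OF d(1)] unfolding L2 by simp
  qed
  have "(\<Sum>y\<in>N v. ext_weight (deg G v) (deg G y) * x y) < L * x v" if v: "v \<in> V" for v
  proof -
    consider "v = c" | "v \<in> V - {c} - M" | "v \<in> M" using v by auto
    then show ?thesis
    proof cases
      case 1
      then show ?thesis using center d(2) by (simp add: x_def)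
    next
      case 2
      have "c \<in> N v" using 2 Nc arc_sym by auto
      moreover have "card (N v) = 1" using deg_leaf[OF 2] by (simp add: deg_eq)
      ultimately have Nv: "N v = {c}" by (metis card_1_singletonE singletonD)
      have "ext_weight 1 d * L < L * ((d + 1/10) / 2)"
        unfolding mult.commute[of L]
        using friendship_leaf[OF d(1)] L by (intro mult_strict_right_mono) (auto simp: ext_weight_def)
      then show ?thesis using 2 Nv d(2) deg_leaf[OF 2] by (auto simp: x_def)
    next
      case 3
      have cN: "c \<in> N v" using 3 M Nc arc_sym by auto
      have "card (N v - {c}) = 1" using 3 by (simp add: M_def deg_off_def)
      then obtain y where y: "N v - {c} = {y}" by (auto simp: card_1_singleton_iff)
      have vc: "v \<noteq> c" using 3 M by auto
      have yV: "y \<in> V - {c}" using y nbrs_subset[of v] by auto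
      moreover have "deg_off c y \<ge> 1" using y vc by (intro deg_off_pos[of v]) auto
      ultimately have yM: "y \<in> M" using off[of y] by (auto simp: M_def)
      have "(\<Sum>y\<in>N v. ext_weight (deg G v) (deg G y) * x y) = ext_weight 2 d * L + 29/100 * d"
        using sum.remove[OF finite_nbrs cN, of "\<lambda>y. ext_weight (deg G v) (deg G y) * x y"] d(2)
          deg_M[OF 3] deg_M[OF yM] y yM yV
        by (simp add: x_def) (simp add: ext_weight_def)
      also have "\<dots> < L * (29/100 * d)"
        using friendship_inner[OF d(1) L] by (simp add: ext_weight_def add.commute)
      finally show ?thesis using 3 vc by (simp add: x_def)
    qed
  qed
  moreover have "x v > 0" for v using d(1) L by (simp add: x_def)
  ultimately have "rho_ex G < L" by (intro rho_ex_less'[where x = x]) auto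
  then show ?thesis by (simp add: L_def)
qed

lemma rho_ex_nonneg: "rho_ex G \<ge> 0"
proof -
  obtain vs where vs: "distinct vs" "set vs = V"
    using finite_distinct_list[OF finite_verts] by blast
  have "length vs > 0" using vs order n12 by auto
  then show ?thesis
    unfolding rho_ex_eq[OF vs] by (intro spectral_radius_nonneg) (auto simp: ext_adj_mat_def)
qed

lemma rho_ex_square_ge_row:
  assumes "u \<in> V"
  shows "(\<Sum>v\<in>N u. (ext_weight (deg G u) (deg G v))\<^sup>2) \<le> (rho_ex G)\<^sup>2"
proof -
  have "(\<Sum>v\<in>V. ext_adj G u v * ext_adj G v u) = (\<Sum>v\<in>N u. (ext_weight (deg G u) (deg G v))\<^sup>2)"
    unfolding sum_ext_adj
  proof (intro sum.cong refl)
    fix v assume "v \<in> N u"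
    then have "ext_adj G v u = ext_weight (deg G v) (deg G u)"
      using arc_sym by (simp add: ext_adj_def ext_weight_def)
    then show "ext_weight (deg G u) (deg G v) * ext_adj G v u = (ext_weight (deg G u) (deg G v))\<^sup>2"
      by (simp add: power2_eq_square ext_weight_commute[of "deg G v"])
  qed
  then show ?thesis using rho_ex_square_ge[OF finite_verts assms] by simp
qed

end

section \<open>Recognizing \<open>G1\<close> and \<open>G2\<close> up to isomorphism\<close>

lemma digraph_isoI:
  assumes "pair_wf_digraph G" "inj_on f (pverts G)"
    and "pverts H = f ` pverts G" "parcs H = map_prod f f ` parcs G"
  shows "digraph_iso (with_proj G) (with_proj H)"
proof -
  interpret pair_wf_digraph G by fact
  let ?h = "\<lparr>iso_verts = f, iso_arcs = map_prod f f, iso_head = snd, iso_tail = fst\<rparr>"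
  have "inj_on (map_prod f f) (parcs G)"
    using assms(2) in_arcsD1 in_arcsD2 by (auto simp: inj_on_def)
  then have "digraph_isomorphism ?h"
    using assms(2) wf_digraph_axioms by (auto simp: digraph_isomorphism_def)
  moreover have "with_proj H = app_iso ?h (with_proj G)"
    using assms(3,4) by (simp add: with_proj_def app_iso_def)
  ultimately show ?thesis unfolding digraph_iso_def by blast
qed

text \<open>List \<open>xs\<close> first and the other elements after it; the numbering is the
  inverse of indexing into this list.\<close>

lemma ex_numbering:
  assumes "finite A" "distinct xs" "set xs \<subseteq> A"
  shows "\<exists>f. bij_betw f A {0..<card A} \<and> (\<forall>i<length xs. f (xs ! i) = i)"
proof -
  obtain ys where ys: "distinct ys" "set ys = A - set xs"
    using finite_distinct_list[of "A - set xs"] assms(1) by auto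
  let ?zs = "xs @ ys"
  have zs: "distinct ?zs" "set ?zs = A" using assms ys by auto
  have len: "length ?zs = card A" using distinct_card[OF zs(1)] zs(2) by simp
  have bij: "bij_betw ((!) ?zs) {0..<card A} A"
    using bij_betw_nth[OF zs(1) refl refl] unfolding len zs(2) lessThan_atLeast0 .
  let ?f = "the_inv_into {0..<card A} ((!) ?zs)"
  have "?f (xs ! i) = i" if i: "i < length xs" for i
  proof -
    have "i \<in> {0..<card A}" using i len by simp
    from the_inv_into_f_f[OF bij_betw_imp_inj_on[OF bij] this] show ?thesis
      using i by (simp only: nth_append if_True)
  qed
  then show ?thesis using bij_betw_the_inv_into[OF bij] by blast
qed

lemma parcs_mk_symmetric_with_proj:
  "parcs (mk_symmetric (with_proj H)) = parcs H \<union> (parcs H)\<inverse>"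
  by (auto simp: parcs_mk_symmetric)

lemma parcs_G1:
  assumes "n \<ge> 4"
  shows "parcs (G1 n) = {0} \<times> {1..<n} \<union> {1..<n} \<times> {0} \<union> {(1, 2), (2, 1), (1, 3), (3, 1)}"
proof -
  have split: "{1..<n} = {1, 2, 3} \<union> {4..<n}" using assms by auto
  \<comment> \<open>The set identity holds for arbitrary vertices and is instantiated
    afterwards.\<close>
  have "P \<union> P\<inverse> = {z} \<times> ({a, b, c} \<union> B) \<union> ({a, b, c} \<union> B) \<times> {z} \<union> {(a, b), (b, a), (a, c), (c, a)}"
    if "P = {(z, a), (z, b), (z, c), (a, b), (a, c)} \<union> (\<lambda>i. (z, i)) ` B"
    for P B and z a b c :: nat
    unfolding that by auto
  from this[OF refl, of 0 1 2 3 "{4..<n}"] show ?thesis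
    unfolding G1_def parcs_mk_symmetric_with_proj split pair_pre_digraph.simps .
qed

lemma parcs_G2:
  assumes "n \<ge> 5"
  shows "parcs (G2 n) = {0} \<times> {1..<n} \<union> {1..<n} \<times> {0} \<union> {(1, 2), (2, 1), (3, 4), (4, 3)}"
proof -
  have split: "{1..<n} = {1, 2, 3, 4} \<union> {5..<n}" using assms by auto
  have "P \<union> P\<inverse> =
      {z} \<times> ({a, b, c, e} \<union> B) \<union> ({a, b, c, e} \<union> B) \<times> {z} \<union> {(a, b), (b, a), (c, e), (e, c)}"
    if "P = {(z, a), (z, b), (a, b), (z, c), (z, e), (c, e)} \<union> (\<lambda>i. (z, i)) ` B"
    for P B and z a b c e :: nat
    unfolding that by auto
  from this[OF refl, of 0 1 2 3 4 "{5..<n}"] show ?thesis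
    unfolding G2_def parcs_mk_symmetric_with_proj split pair_pre_digraph.simps .
qed

lemma pverts_G1: "pverts (G1 n) = {0..<n}" and pverts_G2: "pverts (G2 n) = {0..<n}"
  by (simp_all add: G1_def G2_def)

context bicyclic_graph
begin

text \<open>A graph with a dominating vertex is determined by the arcs avoiding it. The list
  \<open>xs\<close> fixes the numbers of selected vertices, and the last assumption says that these
  numbers already send the remaining arcs to \<open>S\<close>.\<close>

lemma digraph_iso_dominated:
  assumes c: "c \<in> V" "N c = V - {c}" and H: "pverts H = {0..<n}"
    "parcs H = {0} \<times> {1..<n} \<union> {1..<n} \<times> {0} \<union> S"
    and xs: "distinct (c # xs)" "set xs \<subseteq> V"
    and S: "\<And>f. (\<And>i. i < Suc (length xs) \<Longrightarrow> f ((c # xs) ! i) = i) \<Longrightarrow>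
      map_prod f f ` {(u, v) \<in> parcs G. u \<noteq> c \<and> v \<noteq> c} = S"
  shows "digraph_iso (with_proj G) (with_proj H)"
proof -
  let ?R = "{(u, v) \<in> parcs G. u \<noteq> c \<and> v \<noteq> c}"
  obtain f where f: "bij_betw f V {0..<n}" "\<And>i. i < Suc (length xs) \<Longrightarrow> f ((c # xs) ! i) = i"
    using ex_numbering[OF finite_verts xs(1)] xs(2) c(1) order by auto
  have fc: "f c = 0" using f(2)[of 0] by simp
  have inj: "inj_on f V" and img: "f ` V = {0..<n}" using f(1) by (auto simp: bij_betw_def)
  have img': "f ` (V - {c}) = {1..<n}"
    using inj_on_image_set_diff[OF inj, of V "{c}"] c(1) fc img by auto
  have "parcs G = {c} \<times> (V - {c}) \<union> (V - {c}) \<times> {c} \<union> ?R"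
    using c(2) arc_sym arc_verts arc_irrefl by auto
  then have "map_prod f f ` parcs G =
      map_prod f f ` ({c} \<times> (V - {c})) \<union> map_prod f f ` ((V - {c}) \<times> {c}) \<union> map_prod f f ` ?R"
    using image_Un by metis
  also have "map_prod f f ` ({c} \<times> (V - {c})) = {0} \<times> {1..<n}"
    unfolding img'[symmetric] using fc by force
  also have "map_prod f f ` ((V - {c}) \<times> {c}) = {1..<n} \<times> {0}"
    unfolding img'[symmetric] using fc by force
  also have "map_prod f f ` ?R = S" using f(2) by (rule S)
  finally have "parcs H = map_prod f f ` parcs G" using H(2) by simp
  moreover have "pair_wf_digraph G"
  proof -
    interpret pair_graph G by (rule pair_graph)
    show ?thesis by unfold_locales
  qed
  ultimately show ?thesis using inj img H(1) by (intro digraph_isoI[where f = f]) auto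
qed

text \<open>Two edges avoid \<open>c\<close>. If they meet, the graph is \<open>G1\<close>;
  otherwise it is \<open>G2\<close>. The degree bound is recorded in the second case because
  \<open>rho_ex_less_if_friendship\<close> asks for it.\<close>

lemma dominated_cases:
  assumes c: "c \<in> V" "deg G c = n - 1"
  shows "digraph_iso (with_proj G) (with_proj (G1 n)) \<or>
    (digraph_iso (with_proj G) (with_proj (G2 n)) \<and> (\<forall>v\<in>V - {c}. deg_off c v \<le> 1))"
proof -
  let ?R = "{(u, v) \<in> parcs G. u \<noteq> c \<and> v \<noteq> c}"
  have Nc: "N c = V - {c}"
    using nbrs_subset[of c] c finite_verts order by (intro card_subset_eq) (auto simp: deg_eq)
  have total: "(\<Sum>v\<in>V - {c}. deg_off c v) = 4"
    using sum_deg_off[OF c(1)] c(2) n12 by simp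
  have "?R = (SIGMA v:V - {c}. N v - {c})" using arc_verts by auto
  then have cardR: "card ?R = 4"
    using card_SigmaI[of "V - {c}" "\<lambda>v. N v - {c}"] finite_verts finite_nbrs total
    by (simp add: deg_off_def)
  have finR: "finite ?R" by (rule finite_subset[OF _ finite_arcs]) auto
  show ?thesis
  proof (cases "\<forall>v\<in>V - {c}. deg_off c v \<le> 1")
    case False
    then obtain a where a: "a \<in> V - {c}" "\<not> deg_off c a \<le> 1" by blast
    then have "deg_off c a = 2" using deg_off_le[OF a(1)] total by linarith
    then obtain b b' where b: "N a - {c} = {b, b'}" "b \<noteq> b'"
      unfolding deg_off_def card_2_iff by blast
    have bV: "b \<in> V - {c}" "b' \<in> V - {c}" "b \<noteq> a" "b' \<noteq> a" using b(1) nbrs_subset[of a] by auto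
    have arcs: "{(a, b), (b, a), (a, b'), (b', a)} \<subseteq> ?R"
      using b(1) a(1) arc_sym by auto
    have "card {(a, b), (b, a), (a, b'), (b', a)} = 4" using b(2) bV by auto
    then have R: "{(a, b), (b, a), (a, b'), (b', a)} = ?R"
      using arcs cardR finR by (intro card_subset_eq) auto
    have "digraph_iso (with_proj G) (with_proj (G1 n))"
    \<comment> \<open>The common end \<open>a\<close> comes first, since 1 is the second vertex of
      degree 3 in \<open>G1\<close>.\<close>
    proof (rule digraph_iso_dominated[OF c(1) Nc pverts_G1 parcs_G1])
      fix f :: "'a \<Rightarrow> nat"
      assume f: "\<And>i. i < Suc (length [a, b, b']) \<Longrightarrow> f ([c, a, b, b'] ! i) = i"
      have "f a = 1" "f b = 2" "f b' = 3" using f[of 1] f[of 2] f[of 3] by simp_all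
      then show "map_prod f f ` ?R = {(1, 2), (2, 1), (1, 3), (3, 1)}"
        unfolding R[symmetric] by simp
    qed (use a bV b n12 in auto)
    then show ?thesis by blast
  next
    case True
    have "(\<Sum>v\<in>V - {c}. deg_off c v) \<noteq> 0" using total by simp
    then obtain a where a: "a \<in> V - {c}" "deg_off c a \<noteq> 0" by (rule sum.not_neutral_contains_not_neutral)
    moreover have "deg_off c a \<le> 1" using True a(1) by blast
    ultimately have "deg_off c a = 1" by linarith
    then obtain b where b: "N a - {c} = {b}" unfolding deg_off_def by (rule card_1_singletonE)
    have bV: "b \<in> V - {c}" "b \<noteq> a" using b nbrs_subset[of a] by auto
    have ba: "(b, a) \<in> parcs G" using b arc_sym by auto
    have Nb: "N b - {c} = {a}"
    proof -
      have "a \<in> N b - {c}" using ba a by auto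
      moreover have "deg_off c b \<le> 1" using True bV(1) by blast
      then have "card (N b - {c}) \<le> card {a}" by (simp add: deg_off_def)
      ultimately show ?thesis using card_seteq[of "N b - {c}" "{a}"] finite_nbrs[of b] by blast
    qed
    \<comment> \<open>The vertices \<open>a\<close> and \<open>b\<close> account for only 2 of the
      total 4, so some other vertex \<open>p\<close> lies on the second edge.\<close>
    have "(\<Sum>v\<in>V - {c}. deg_off c v) = (\<Sum>v\<in>V - {c} - {a, b}. deg_off c v) + (\<Sum>v\<in>{a, b}. deg_off c v)"
      using a bV finite_verts by (intro sum.subset_diff) auto
    also have "(\<Sum>v\<in>{a, b}. deg_off c v) \<le> 2" using b Nb bV by (simp add: deg_off_def)
    finally have "(\<Sum>v\<in>V - {c} - {a, b}. deg_off c v) \<noteq> 0" using total by simp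
    then obtain p where p: "p \<in> V - {c} - {a, b}" "deg_off c p \<noteq> 0"
      by (rule sum.not_neutral_contains_not_neutral)
    then have "N p - {c} \<noteq> {}" unfolding deg_off_def by fastforce
    then obtain q where q: "q \<in> N p - {c}" by blast
    have qV: "q \<in> V - {c}" "q \<noteq> p" using q nbrs_subset[of p] by auto
    have qp: "(q, p) \<in> parcs G" using q arc_sym by auto
    have qab: "q \<noteq> a" "q \<noteq> b" using qp p b Nb by auto
    have arcs: "{(a, b), (b, a), (p, q), (q, p)} \<subseteq> ?R"
      using b ba q qp a bV p qV by auto
    have "card {(a, b), (b, a), (p, q), (q, p)} = 4" using bV p qV qab by auto
    then have R: "{(a, b), (b, a), (p, q), (q, p)} = ?R"
      using arcs cardR finR by (intro card_subset_eq) auto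
    have "digraph_iso (with_proj G) (with_proj (G2 n))"
    proof (rule digraph_iso_dominated[OF c(1) Nc pverts_G2 parcs_G2])
      fix f :: "'a \<Rightarrow> nat"
      assume f: "\<And>i. i < Suc (length [a, b, p, q]) \<Longrightarrow> f ([c, a, b, p, q] ! i) = i"
      have "f a = 1" "f b = 2" "f p = 3" "f q = 4" using f[of 1] f[of 2] f[of 3] f[of 4] by simp_all
      then show "map_prod f f ` ?R = {(1, 2), (2, 1), (3, 4), (4, 3)}"
        unfolding R[symmetric] by simp
    qed (use a bV p qV qab n12 in auto)
    then show ?thesis using True by blast
  qed
qed

text \<open>The case distinction is on the maximum degree. The copies of \<open>G2\<close> carry an
  explicit upper bound, so they can be compared with \<open>G1\<close> without invoking invariance
  of \<open>rho_ex\<close> under isomorphism.\<close>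

lemma rho_ex_cases:
  "rho_ex G < 1/2 * (real n - 0.9) * sqrt (real n - 5) \<or>
   digraph_iso (with_proj G) (with_proj (G1 n)) \<or>
   (digraph_iso (with_proj G) (with_proj (G2 n)) \<and>
     rho_ex G < 1/2 * (real n - 0.9) * sqrt (real n - 3.8))"
proof (cases "\<exists>c\<in>V. deg G c = n - 1")
  case True
  then obtain c where c: "c \<in> V" "deg G c = n - 1" by blast
  then show ?thesis using dominated_cases[OF c] rho_ex_less_if_friendship[OF c] by blast
next
  case no_dom: False
  show ?thesis
  proof (cases "\<exists>c\<in>V. deg G c = n - 2")
    case True
    then obtain c where "c \<in> V" "deg G c = n - 2" by blast
    then show ?thesis using rho_ex_less_if_near_star by simp
  next
    case False
    have "deg G u \<le> n - 3" if "u \<in> V" for u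
    proof -
      have "deg G u \<noteq> n - 1" "deg G u \<noteq> n - 2" using that no_dom False by auto
      then show ?thesis using deg_le[OF that] by linarith
    qed
    then show ?thesis using rho_ex_less_if_sparse by simp
  qed
qed

end

section \<open>The extremal graphs\<close>

text \<open>The vertex \<open>c\<close> is adjacent to all others, so any two vertices are joined
  through it; the edge count is half the arc count.\<close>

lemma bicyclicI:
  assumes fin: "finite (pverts H)" and sym: "sym (parcs H)" and irrefl: "irrefl (parcs H)"
    and sub: "parcs H \<subseteq> pverts H \<times> pverts H"
    and c: "c \<in> pverts H" "\<And>v. v \<in> pverts H - {c} \<Longrightarrow> (c, v) \<in> parcs H"
    and card: "card (parcs H) = 2 * card (pverts H) + 2"
  shows "bicyclic H"
proof -
  have fin': "finite (parcs H)" using sub fin by (metis finite_SigmaI finite_subset)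
  interpret pair_graph H
  proof unfold_locales
    show "symmetric (with_proj H)" using sym by (simp add: symmetric_def)
  qed (use fin fin' sub irrefl in \<open>auto simp: irrefl_def\<close>)
  have arc_reach: "u \<rightarrow>\<^sup>*\<^bsub>with_proj H\<^esub> v" if "(u, v) \<in> parcs H" for u v
    using that by (intro reachable_adjI) simp
  have reach: "c \<rightarrow>\<^sup>*\<^bsub>with_proj H\<^esub> v \<and> v \<rightarrow>\<^sup>*\<^bsub>with_proj H\<^esub> c" if v: "v \<in> pverts H" for v
  proof (cases "v = c")
    case True
    then show ?thesis using c(1) reachable_refl by simp
  next
    case False
    then have "(c, v) \<in> parcs H" using v c(2) by simp
    then show ?thesis using arc_reach arcs_symmetric by blast
  qed
  have "Digraph_Component.connected (with_proj H)"
  proof (rule connectedI)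
    show "pverts H \<noteq> {}" using c(1) by auto
    fix u v assume "u \<in> pverts H" "v \<in> pverts H"
    then have "u \<rightarrow>\<^sup>*\<^bsub>with_proj H\<^esub> v"
      using reach[of u] reach[of v] reachable_trans by auto
    then show "u \<rightarrow>\<^sup>*\<^bsub>with_proj (mk_symmetric (with_proj H))\<^esub> v"
      by (rule reachable_mk_symmetricI)
  qed
  moreover have "card (edges H) = card (pverts H) + 1"
    using card_sym_irrefl_rel[OF fin' sym irrefl] card by (simp add: edges_def)
  moreover have "pair_graph H" by (rule pair_graph)
  ultimately show ?thesis by (simp add: bicyclic_def)
qed

lemma card_star_arcs:
  fixes S :: "(nat \<times> nat) set"
  assumes "n \<ge> 1" "finite S" "S \<subseteq> {1..<n} \<times> {1..<n}"
  shows "card ({0} \<times> {1..<n} \<union> {1..<n} \<times> {0} \<union> S) = 2 * (n - 1) + card S"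
proof -
  have "card ({0} \<times> {1..<n} \<union> {1..<n} \<times> {0} \<union> S) =
      card ({0} \<times> {1..<n} \<union> {1..<n} \<times> {0 :: nat}) + card S"
    using assms by (intro card_Un_disjoint) auto
  also have "card ({0} \<times> {1..<n} \<union> {1..<n} \<times> {0 :: nat}) = card ({0 :: nat} \<times> {1..<n}) + card ({1..<n} \<times> {0 :: nat})"
    by (intro card_Un_disjoint) auto
  finally show ?thesis by (simp add: card_cartesian_product)
qed

lemma bicyclic_G1:
  assumes "n \<ge> 4"
  shows "bicyclic (G1 n)"
proof (rule bicyclicI[where c = 0])
  have "card (parcs (G1 n)) = 2 * (n - 1) + card {(1::nat, 2::nat), (2, 1), (1, 3), (3, 1)}"
    unfolding parcs_G1[OF assms] using assms by (intro card_star_arcs) auto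
  then show "card (parcs (G1 n)) = 2 * card (pverts (G1 n)) + 2"
    using assms by (simp add: pverts_G1)
qed (use assms in \<open>auto simp: pverts_G1 parcs_G1 sym_def irrefl_def\<close>)

lemma bicyclic_G2:
  assumes "n \<ge> 5"
  shows "bicyclic (G2 n)"
proof (rule bicyclicI[where c = 0])
  have "card (parcs (G2 n)) = 2 * (n - 1) + card {(1::nat, 2::nat), (2, 1), (3, 4), (4, 3)}"
    unfolding parcs_G2[OF assms] using assms by (intro card_star_arcs) auto
  then show "card (parcs (G2 n)) = 2 * card (pverts (G2 n)) + 2"
    using assms by (simp add: pverts_G2)
qed (use assms in \<open>auto simp: pverts_G2 parcs_G2 sym_def irrefl_def\<close>)

section \<open>Spectral radii of the extremal graphs\<close>

lemma less_rho_exI: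
  assumes "bicyclic_graph G n" "u \<in> pverts G" "0 \<le> a" "0 \<le> b"
    and "a\<^sup>2 * b / 4 < (\<Sum>v\<in>parcs G `` {u}. (ext_weight (deg G u) (deg G v))\<^sup>2)"
  shows "1/2 * a * sqrt b < rho_ex G"
proof -
  interpret bicyclic_graph G n by fact
  have "(1/2 * a * sqrt b)\<^sup>2 < (rho_ex G)\<^sup>2"
    using rho_ex_square_ge_row[OF assms(2)] assms(5) threshold_square[OF assms(3,4)] by linarith
  then show ?thesis using rho_ex_nonneg by (rule power_less_imp_less_base)
qed

text \<open>In the row of vertex 0 there are one neighbour of degree 3, two of degree 2 and
  \<open>n - 4 = d - 3\<close> leaves.\<close>

lemma rho_ex_G1_gt:
  assumes n: "n \<ge> 12"
  shows "1/2 * (real n - 0.9) * sqrt (real n - 3.8) < rho_ex (G1 n)"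
proof (rule less_rho_exI[where u = 0])
  show bg: "bicyclic_graph (G1 n) n"
    using n bicyclic_G1 by unfold_locales (auto simp: pverts_G1)
  interpret bicyclic_graph "G1 n" n by (rule bg)
  have P: "parcs (G1 n) = {0} \<times> {1..<n} \<union> {1..<n} \<times> {0} \<union> {(1, 2), (2, 1), (1, 3), (3, 1)}"
    using n by (intro parcs_G1) simp
  have split: "{1..<n} = {1, 2, 3} \<union> {4..<n}" using n by auto
  have N0: "N 0 = {1..<n}" and N1: "N 1 = {0, 2, 3}" and N2: "N 2 = {0, 1}" and N3: "N 3 = {0, 1}"
    using n by (auto simp: P)
  have N4: "N v = {0}" if "v \<in> {4..<n}" for v using that by (auto simp: P)
  have deg4: "deg (G1 n) v = 1" if "v \<in> {4..<n}" for v using N4[OF that] by (simp add: deg_eq)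
  have deg: "deg (G1 n) 0 = n - 1" "deg (G1 n) 1 = 3" "deg (G1 n) 2 = 2" "deg (G1 n) 3 = 2"
    using N0 N1 N2 N3 by (simp_all add: deg_eq)
  define d where "d = real n - 1"
  have d: "d \<ge> 11" "real (n - 1) = d" using n by (auto simp: d_def)
  have "(\<Sum>v\<in>N 0. (ext_weight (deg (G1 n) 0) (deg (G1 n) v))\<^sup>2) =
      (\<Sum>v\<in>{1, 2, 3}. (ext_weight d (deg (G1 n) v))\<^sup>2) + (\<Sum>v\<in>{4..<n}. (ext_weight d (deg (G1 n) v))\<^sup>2)"
    unfolding N0 deg(1) d(2) split by (rule sum.union_disjoint) auto
  also have "(\<Sum>v\<in>{4..<n}. (ext_weight d (deg (G1 n) v))\<^sup>2) = (\<Sum>v\<in>{4..<n}. (ext_weight d 1)\<^sup>2)"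
    using deg4 by (intro sum.cong) auto
  also have "\<dots> = (d - 3) * (ext_weight d 1)\<^sup>2" using n by (simp add: d_def of_nat_diff)
  also have "(\<Sum>v\<in>{1, 2, 3}. (ext_weight d (deg (G1 n) v))\<^sup>2) = 2 * (ext_weight d 2)\<^sup>2 + (ext_weight d 3)\<^sup>2"
    using deg by simp
  finally have sum_eq: "(\<Sum>v\<in>N 0. (ext_weight (deg (G1 n) 0) (deg (G1 n) v))\<^sup>2) =
    2 * (ext_weight d 2)\<^sup>2 + (ext_weight d 3)\<^sup>2 + (d - 3) * (ext_weight d 1)\<^sup>2" .
  have eqs: "real n - 0.9 = d + 1/10" "real n - 3.8 = d - 14/5" by (simp_all add: d_def)
  show "(real n - 0.9)\<^sup>2 * (real n - 3.8) / 4 <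
      (\<Sum>v\<in>N 0. (ext_weight (deg (G1 n) 0) (deg (G1 n) v))\<^sup>2)"
    unfolding sum_eq eqs using G1_center_lower[OF d(1)] by simp
qed (use n in \<open>auto simp: pverts_G1\<close>)

lemma rho_ex_G2_bounds:
  assumes n: "n \<ge> 12"
  shows "1/2 * (real n - 0.9) * sqrt (real n - 5) < rho_ex (G2 n)"
    and "rho_ex (G2 n) < 1/2 * (real n - 0.9) * sqrt (real n - 3.8)"
proof -
  have bg: "bicyclic_graph (G2 n) n"
    using n bicyclic_G2 by unfold_locales (auto simp: pverts_G2)
  interpret bicyclic_graph "G2 n" n by (rule bg)
  have P: "parcs (G2 n) = {0} \<times> {1..<n} \<union> {1..<n} \<times> {0} \<union> {(1, 2), (2, 1), (3, 4), (4, 3)}"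
    using n by (intro parcs_G2) simp
  have split: "{1..<n} = {1, 2, 3, 4} \<union> {5..<n}" using n by auto
  have N0: "N 0 = {1..<n}" and N14: "N 1 = {0, 2}" "N 2 = {0, 1}" "N 3 = {0, 4}" "N 4 = {0, 3}"
    using n by (auto simp: P)
  have N5: "N v = {0}" if "v \<in> {5..<n}" for v using that by (auto simp: P)
  have deg0: "deg (G2 n) 0 = n - 1" using N0 by (simp add: deg_eq)
  have zero: "0 \<in> V" using n by (simp add: pverts_G2)
  show "1/2 * (real n - 0.9) * sqrt (real n - 5) < rho_ex (G2 n)"
  proof (rule less_rho_exI[where u = 0, OF bg zero])
    have deg5: "deg (G2 n) v = 1" if "v \<in> {5..<n}" for v using N5[OF that] by (simp add: deg_eq)
    have deg: "deg (G2 n) 1 = 2" "deg (G2 n) 2 = 2" "deg (G2 n) 3 = 2" "deg (G2 n) 4 = 2"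
      using N14 by (simp_all add: deg_eq)
    define d where "d = real n - 1"
    have d: "d \<ge> 11" "real (n - 1) = d" using n by (auto simp: d_def)
    have "(\<Sum>v\<in>N 0. (ext_weight (deg (G2 n) 0) (deg (G2 n) v))\<^sup>2) =
        (\<Sum>v\<in>{1, 2, 3, 4}. (ext_weight d (deg (G2 n) v))\<^sup>2) + (\<Sum>v\<in>{5..<n}. (ext_weight d (deg (G2 n) v))\<^sup>2)"
      unfolding N0 deg0 d(2) split by (rule sum.union_disjoint) auto
    also have "(\<Sum>v\<in>{5..<n}. (ext_weight d (deg (G2 n) v))\<^sup>2) = (\<Sum>v\<in>{5..<n}. (ext_weight d 1)\<^sup>2)"
      using deg5 by (intro sum.cong) auto
    also have "\<dots> = (d - 4) * (ext_weight d 1)\<^sup>2" using n by (simp add: d_def of_nat_diff)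
    also have "(\<Sum>v\<in>{1, 2, 3, 4}. (ext_weight d (deg (G2 n) v))\<^sup>2) = 4 * (ext_weight d 2)\<^sup>2"
      using deg by simp
    finally have sum_eq: "(\<Sum>v\<in>N 0. (ext_weight (deg (G2 n) 0) (deg (G2 n) v))\<^sup>2) =
      4 * (ext_weight d 2)\<^sup>2 + (d - 4) * (ext_weight d 1)\<^sup>2" .
    have eqs: "real n - 0.9 = d + 1/10" "real n - 5 = d - 4" by (simp_all add: d_def)
    show "(real n - 0.9)\<^sup>2 * (real n - 5) / 4 <
        (\<Sum>v\<in>N 0. (ext_weight (deg (G2 n) 0) (deg (G2 n) v))\<^sup>2)"
      unfolding sum_eq eqs using G2_center_lower[OF d(1)] by simp
  qed (use n in auto)
  show "rho_ex (G2 n) < 1/2 * (real n - 0.9) * sqrt (real n - 3.8)"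
  proof (rule rho_ex_less_if_friendship[OF zero deg0])
    fix v assume "v \<in> V - {0}"
    then have "v \<in> {1, 2, 3, 4} \<union> {5..<n}" using split by (auto simp: pverts_G2)
    then show "deg_off 0 v \<le> 1" using N14 N5 by (auto simp: deg_off_def simp del: Image_singleton_iff)
  qed
qed

theorem theorem4p1:
  fixes n :: nat
  assumes "n \<ge> 12"
  shows "bicyclic (G1 n) \<and> card (pverts (G1 n)) = n \<and>
    bicyclic (G2 n) \<and> card (pverts (G2 n)) = n \<and>
    (\<forall>G :: 'a pair_pre_digraph.
       bicyclic G \<and> card (pverts G) = n \<and>
       \<not> digraph_iso (with_proj G) (with_proj (G1 n)) \<longrightarrow>
       rho_ex G < rho_ex (G1 n)) \<and>
    (\<forall>G :: 'a pair_pre_digraph.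
       bicyclic G \<and> card (pverts G) = n \<and>
       \<not> digraph_iso (with_proj G) (with_proj (G1 n)) \<and>
       \<not> digraph_iso (with_proj G) (with_proj (G2 n)) \<longrightarrow>
       rho_ex G < rho_ex (G2 n)) \<and>
    rho_ex (G1 n) > 1/2 * (real n - 0.9) * sqrt (real n - 3.8) \<and>
    1/2 * (real n - 0.9) * sqrt (real n - 3.8) > rho_ex (G2 n) \<and>
    rho_ex (G2 n) > 1/2 * (real n - 0.9) * sqrt (real n - 5)"
proof -
  note G1 = rho_ex_G1_gt[OF assms] and G2 = rho_ex_G2_bounds[OF assms]
  \<comment> \<open>The smaller threshold lies below \<open>rho_ex (G2 n)\<close> and the larger one
    below \<open>rho_ex (G1 n)\<close>, which turns \<open>rho_ex_cases\<close> into comparisons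
    with the extremal graphs.\<close>
  have cases: "rho_ex G < rho_ex (G2 n) \<or> digraph_iso (with_proj G) (with_proj (G1 n)) \<or>
      (digraph_iso (with_proj G) (with_proj (G2 n)) \<and> rho_ex G < rho_ex (G1 n))"
    if "bicyclic G" "card (pverts G) = n" for G :: "'a pair_pre_digraph"
  proof -
    interpret bicyclic_graph G n using that assms by unfold_locales
    show ?thesis using rho_ex_cases G1 G2 by linarith
  qed
  have "rho_ex G < rho_ex (G1 n)"
    if "bicyclic G" "card (pverts G) = n" "\<not> digraph_iso (with_proj G) (with_proj (G1 n))"
    for G :: "'a pair_pre_digraph"
    using cases[OF that(1,2)] that(3) G1 G2 by linarith
  then show ?thesis
    using cases G1 G2 bicyclic_G1[of n] bicyclic_G2[of n] assms
    by (auto simp: pverts_G1 pverts_G2)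
qed

end
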